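(* Let $G$ be a group of central type. If both $[\alpha]\in H^2(G,\mathbb{C}^* )$ and its restriction to a normal subgroup $N\lhd G$ are non-degenerate, then the quotient group $G/N$ is of central type.
   Context: For a finite group $G$ and a 2-cocycle $\alpha\in Z^2(G,\mathbb{C}^* )$ (trivial action), the twisted group algebra is $\mathbb{C}^{\alpha}G=\bigoplus_{g\in G}\mathbb{C}u_g$ with $u_gu_h=\alpha(g,h)u_{gh}$. The class $[\alpha]\in H^2(G,\mathbb{C}^* )$ is non-degenerate if $\mathbb{C}^{\alpha}G$ is a simple algebra, i.e. isomorphic to a matrix algebra $M_n(\mathbb{C})$. A finite group is of central type (CT) if it admits a non-degenerate class in $H^2(G,\mathbb{C}^* )$. *)

theory Defs
  imports Complex_Main "HOL-Algebra.Algebra"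
begin

definition Z2 :: "('a, 'm) monoid_scheme \<Rightarrow> ('a \<times> 'a \<Rightarrow> complex) monoid" where
  "Z2 G = \<lparr>carrier = {\<alpha> \<in> carrier G \<times> carrier G \<rightarrow>\<^sub>E UNIV - {0}.
              \<forall>g \<in> carrier G. \<forall>h \<in> carrier G. \<forall>k \<in> carrier G.
                \<alpha> (g, h) * \<alpha> (g \<otimes>\<^bsub>G\<^esub> h, k) = \<alpha> (h, k) * \<alpha> (g, h \<otimes>\<^bsub>G\<^esub> k)},
            monoid.mult = (\<lambda>\<alpha> \<beta>. \<lambda>p \<in> carrier G \<times> carrier G. \<alpha> p * \<beta> p),
            monoid.one = (\<lambda>p \<in> carrier G \<times> carrier G. 1)\<rparr>"

definition coboundary :: "('a, 'm) monoid_scheme \<Rightarrow> ('a \<Rightarrow> complex) \<Rightarrow> 'a \<times> 'a \<Rightarrow> complex" where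
  "coboundary G c = (\<lambda>(g, h) \<in> carrier G \<times> carrier G. c g * c h / c (g \<otimes>\<^bsub>G\<^esub> h))"

definition B2 :: "('a, 'm) monoid_scheme \<Rightarrow> ('a \<times> 'a \<Rightarrow> complex) set" where
  "B2 G = coboundary G ` (carrier G \<rightarrow> UNIV - {0})"

definition H2 :: "('a, 'm) monoid_scheme \<Rightarrow> ('a \<times> 'a \<Rightarrow> complex) set monoid" where
  "H2 G = Z2 G Mod B2 G"

definition cohomology_class ::
    "('a, 'm) monoid_scheme \<Rightarrow> ('a \<times> 'a \<Rightarrow> complex) \<Rightarrow> ('a \<times> 'a \<Rightarrow> complex) set" where
  "cohomology_class G \<alpha> = B2 G #>\<^bsub>Z2 G\<^esub> \<alpha>"

text \<open>An element \<open>f\<close> of the twisted group algebra stands for the sum of \<open>f g\<close> times the basis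
  vector of \<open>g\<close>, for \<open>g\<close> in \<open>G\<close>. Cocycles are not assumed to be normalized, hence the scalar
  factor in the unit element.\<close>

definition twisted_group_algebra ::
    "('a, 'm) monoid_scheme \<Rightarrow> ('a \<times> 'a \<Rightarrow> complex) \<Rightarrow> ('a \<Rightarrow> complex) ring" where
  "twisted_group_algebra G \<alpha> =
     \<lparr>carrier = carrier G \<rightarrow>\<^sub>E UNIV,
      monoid.mult = (\<lambda>f f'. \<lambda>x \<in> carrier G.
        \<Sum>(g, h) | g \<in> carrier G \<and> h \<in> carrier G \<and> g \<otimes>\<^bsub>G\<^esub> h = x. f g * f' h * \<alpha> (g, h)),
      monoid.one = (\<lambda>x \<in> carrier G. if x = \<one>\<^bsub>G\<^esub> then inverse (\<alpha> (\<one>\<^bsub>G\<^esub>, \<one>\<^bsub>G\<^esub>)) else 0),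
      ring.zero = (\<lambda>x \<in> carrier G. 0),
      ring.add = (\<lambda>f f'. \<lambda>x \<in> carrier G. f x + f' x)\<rparr>"

text \<open>Being unital, the twisted group algebra has the same two-sided ideals as a ring and as a
  complex algebra (see \<open>twisted_ideal_scale\<close> below), so simplicity can be expressed for the
  underlying ring.\<close>

definition simple_ring :: "('a, 'm) ring_scheme \<Rightarrow> bool" where
  "simple_ring R \<longleftrightarrow> ring R \<and> \<one>\<^bsub>R\<^esub> \<noteq> \<zero>\<^bsub>R\<^esub> \<and> (\<forall>I. ideal I R \<longrightarrow> I = {\<zero>\<^bsub>R\<^esub>} \<or> I = carrier R)"

text \<open>The choice of the representative does not matter: see \<open>nondegenerate_iff\<close> below.\<close>

definition nondegenerate ::
    "('a, 'm) monoid_scheme \<Rightarrow> ('a \<times> 'a \<Rightarrow> complex) set \<Rightarrow> bool" where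
  "nondegenerate G c \<longleftrightarrow> (\<exists>\<alpha> \<in> c. simple_ring (twisted_group_algebra G \<alpha>))"

definition central_type :: "('a, 'm) monoid_scheme \<Rightarrow> bool" where
  "central_type G \<longleftrightarrow> group G \<and> finite (carrier G) \<and> (\<exists>c \<in> carrier (H2 G). nondegenerate G c)"

lemma Z2_comm_group:
  fixes G (structure)
  assumes "group G"
  shows "comm_group (Z2 G)"
proof -
  interpret group G by fact
  show ?thesis
  proof (rule comm_groupI)
    fix x assume x: "x \<in> carrier (Z2 G)"
    let ?y = "\<lambda>p \<in> carrier G \<times> carrier G. inverse (x p)"
    have nz: "x (g, h) \<noteq> 0" if "g \<in> carrier G" "h \<in> carrier G" for g h
      using x that by (auto simp: Z2_def PiE_def Pi_def)
    have "?y \<in> carrier (Z2 G)"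
      using x nz by (auto simp: Z2_def PiE_def Pi_def simp flip: inverse_mult_distrib)
    moreover have "?y \<otimes>\<^bsub>Z2 G\<^esub> x = \<one>\<^bsub>Z2 G\<^esub>"
      using nz by (auto simp: Z2_def restrict_def fun_eq_iff)
    ultimately show "\<exists>y \<in> carrier (Z2 G). y \<otimes>\<^bsub>Z2 G\<^esub> x = \<one>\<^bsub>Z2 G\<^esub>" by blast
  next
    fix x y assume "x \<in> carrier (Z2 G)" "y \<in> carrier (Z2 G)"
    then have "x (g, h) * y (g, h) * (x (g \<otimes> h, k) * y (g \<otimes> h, k)) =
               x (h, k) * y (h, k) * (x (g, h \<otimes> k) * y (g, h \<otimes> k))"
      if "g \<in> carrier G" "h \<in> carrier G" "k \<in> carrier G" for g h k
    proof -
      have "x (g, h) * x (g \<otimes> h, k) = x (h, k) * x (g, h \<otimes> k)"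
           "y (g, h) * y (g \<otimes> h, k) = y (h, k) * y (g, h \<otimes> k)"
        using that \<open>x \<in> _\<close> \<open>y \<in> _\<close> by (auto simp: Z2_def)
      from arg_cong2[OF this, of "(*)"] show ?thesis by (simp add: mult_ac)
    qed
    then show "x \<otimes>\<^bsub>Z2 G\<^esub> y \<in> carrier (Z2 G)"
      using \<open>x \<in> _\<close> \<open>y \<in> _\<close> by (auto simp: Z2_def PiE_def Pi_def)
  qed (auto simp: Z2_def PiE_def extensional_def restrict_def fun_eq_iff)
qed

lemma coboundary_in_Z2:
  assumes "group G" "c \<in> carrier G \<rightarrow> UNIV - {0}"
  shows "coboundary G c \<in> carrier (Z2 G)"
proof -
  interpret group G by fact
  have "c g \<noteq> 0" if "g \<in> carrier G" for g using assms(2) that by auto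
  then show ?thesis
    by (auto simp: Z2_def coboundary_def m_assoc split: if_splits)
qed

lemma B2_normal:
  assumes "group G"
  shows "B2 G \<lhd> Z2 G"
proof -
  interpret group G by fact
  interpret Z: comm_group "Z2 G" by (rule Z2_comm_group) fact
  have "subgroup (B2 G) (Z2 G)"
  proof (rule Z.subgroupI)
    show "B2 G \<subseteq> carrier (Z2 G)"
      using coboundary_in_Z2 assms by (auto simp: B2_def)
    have "(\<lambda>_. 1) \<in> carrier G \<rightarrow> UNIV - {0 :: complex}" by auto
    then show "B2 G \<noteq> {}" unfolding B2_def by blast
  next
    fix a assume "a \<in> B2 G"
    then obtain c where c: "a = coboundary G c" "c \<in> carrier G \<rightarrow> UNIV - {0}"
      by (auto simp: B2_def)
    let ?d = "\<lambda>x. inverse (c x)"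
    have nz: "c g \<noteq> 0" if "g \<in> carrier G" for g using c that by auto
    have d: "?d \<in> carrier G \<rightarrow> UNIV - {0}" using nz by auto
    have "coboundary G ?d \<otimes>\<^bsub>Z2 G\<^esub> a = \<one>\<^bsub>Z2 G\<^esub>"
      using nz by (auto simp: c Z2_def coboundary_def restrict_def fun_eq_iff field_simps)
    then have "inv\<^bsub>Z2 G\<^esub> a = coboundary G ?d"
      using Z.inv_equality coboundary_in_Z2[OF assms] c d by metis
    then show "inv\<^bsub>Z2 G\<^esub> a \<in> B2 G" using d by (auto simp: B2_def)
  next
    fix a b assume "a \<in> B2 G" "b \<in> B2 G"
    then obtain c d where c: "a = coboundary G c" "c \<in> carrier G \<rightarrow> UNIV - {0}"
      and d: "b = coboundary G d" "d \<in> carrier G \<rightarrow> UNIV - {0}"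
      by (auto simp: B2_def)
    have "a \<otimes>\<^bsub>Z2 G\<^esub> b = coboundary G (\<lambda>x. c x * d x)"
      by (auto simp: c d Z2_def coboundary_def restrict_def fun_eq_iff)
    moreover have "(\<lambda>x. c x * d x) \<in> carrier G \<rightarrow> UNIV - {0}" using c d by auto
    ultimately show "a \<otimes>\<^bsub>Z2 G\<^esub> b \<in> B2 G" by (auto simp: B2_def)
  qed
  then show ?thesis by (simp add: Z.normal_iff_subgroup)
qed

lemma H2_comm_group: "group G \<Longrightarrow> comm_group (H2 G)"
  unfolding H2_def
  by (simp add: B2_normal Z2_comm_group comm_group.abelian_FactGroup normal_imp_subgroup)

lemma cohomology_class_in_H2: "\<alpha> \<in> carrier (Z2 G) \<Longrightarrow> cohomology_class G \<alpha> \<in> carrier (H2 G)"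
  by (auto simp: H2_def FactGroup_def cohomology_class_def RCOSETS_def)

lemma restrict_in_Z2:
  assumes "group G" "subgroup K G" "\<alpha> \<in> carrier (Z2 G)"
  shows "restrict \<alpha> (K \<times> K) \<in> carrier (Z2 (G\<lparr>carrier := K\<rparr>))"
proof -
  interpret subgroup K G by fact
  show ?thesis using assms(3) subset by (auto simp: Z2_def PiE_def Pi_def subset_iff)
qed

lemma restrict_in_B2:
  assumes "group G" "subgroup K G" "\<beta> \<in> B2 G"
  shows "restrict \<beta> (K \<times> K) \<in> B2 (G\<lparr>carrier := K\<rparr>)"
proof -
  interpret subgroup K G by fact
  obtain c where c: "\<beta> = coboundary G c" "c \<in> carrier G \<rightarrow> UNIV - {0}"
    using assms by (auto simp: B2_def)
  have "restrict \<beta> (K \<times> K) = coboundary (G\<lparr>carrier := K\<rparr>) c"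
    by (auto simp: c coboundary_def restrict_def fun_eq_iff)
  moreover have "c \<in> carrier (G\<lparr>carrier := K\<rparr>) \<rightarrow> UNIV - {0}"
    using c subset by (auto simp: Pi_def)
  ultimately show ?thesis unfolding B2_def by blast
qed

lemma twisted_ring:
  fixes G (structure)
  assumes "group G" "finite (carrier G)" "\<alpha> \<in> carrier (Z2 G)"
  shows "ring (twisted_group_algebra G \<alpha>)" (is "ring ?A")
proof -
  interpret group G by fact
  define P where "P x = {(g, h). g \<in> carrier G \<and> h \<in> carrier G \<and> g \<otimes> h = x}" for x
  have finP: "finite (P x)" for x
    by (rule finite_subset[of _ "carrier G \<times> carrier G"]) (auto simp: P_def assms)
  have mult: "f \<otimes>\<^bsub>?A\<^esub> f' = (\<lambda>x \<in> carrier G. \<Sum>(g, h) \<in> P x. f g * f' h * \<alpha> (g, h))" for f f'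
    by (simp add: twisted_group_algebra_def P_def)
  have add: "f \<oplus>\<^bsub>?A\<^esub> f' = (\<lambda>x \<in> carrier G. f x + f' x)" for f f'
    by (simp add: twisted_group_algebra_def)
  have carr: "carrier ?A = carrier G \<rightarrow>\<^sub>E UNIV"
    by (simp add: twisted_group_algebra_def)
  have zero: "\<zero>\<^bsub>?A\<^esub> = (\<lambda>x \<in> carrier G. 0)"
    by (simp add: twisted_group_algebra_def)
  have unit: "\<one>\<^bsub>?A\<^esub> = (\<lambda>x \<in> carrier G. if x = \<one> then inverse (\<alpha> (\<one>, \<one>)) else 0)"
    by (simp add: twisted_group_algebra_def)
  have nz: "\<alpha> (g, h) \<noteq> 0" if "g \<in> carrier G" "h \<in> carrier G" for g h
    using assms(3) that by (auto simp: Z2_def PiE_def Pi_def)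
  have coc: "\<alpha> (g, h) * \<alpha> (g \<otimes> h, k) = \<alpha> (h, k) * \<alpha> (g, h \<otimes> k)"
    if "g \<in> carrier G" "h \<in> carrier G" "k \<in> carrier G" for g h k
    using assms(3) that by (auto simp: Z2_def)
  have a1: "\<alpha> (\<one>, x) = \<alpha> (\<one>, \<one>)" "\<alpha> (x, \<one>) = \<alpha> (\<one>, \<one>)" if "x \<in> carrier G" for x
    using coc[of \<one> \<one> x] coc[of x \<one> \<one>] that nz by auto
  have abel: "abelian_group ?A"
  proof (rule abelian_groupI)
    fix x assume "x \<in> carrier ?A"
    then show "\<exists>y \<in> carrier ?A. y \<oplus>\<^bsub>?A\<^esub> x = \<zero>\<^bsub>?A\<^esub>"
      by (intro bexI[of _ "\<lambda>g \<in> carrier G. - x g"])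
         (auto simp: carr add zero restrict_def fun_eq_iff)
  qed (auto simp: carr add zero restrict_def PiE_def extensional_def fun_eq_iff)
  have assoc: "f \<otimes>\<^bsub>?A\<^esub> f' \<otimes>\<^bsub>?A\<^esub> f'' = f \<otimes>\<^bsub>?A\<^esub> (f' \<otimes>\<^bsub>?A\<^esub> f'')" for f f' f''
  proof
    fix x
    show "(f \<otimes>\<^bsub>?A\<^esub> f' \<otimes>\<^bsub>?A\<^esub> f'') x = (f \<otimes>\<^bsub>?A\<^esub> (f' \<otimes>\<^bsub>?A\<^esub> f'')) x"
    proof (cases "x \<in> carrier G")
      case True
      have "(f \<otimes>\<^bsub>?A\<^esub> f' \<otimes>\<^bsub>?A\<^esub> f'') x =
          (\<Sum>p \<in> P x. \<Sum>q \<in> P (fst p).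
             f (fst q) * f' (snd q) * \<alpha> q * f'' (snd p) * \<alpha> p)"
        using True
        by (auto simp: mult case_prod_beta sum_distrib_right P_def intro!: sum.cong)
      also have "\<dots> = (\<Sum>(p, q) \<in> Sigma (P x) (\<lambda>p. P (fst p)).
             f (fst q) * f' (snd q) * \<alpha> q * f'' (snd p) * \<alpha> p)"
        by (rule sum.Sigma) (auto simp: finP)
      also have "\<dots> = (\<Sum>(p, q) \<in> Sigma (P x) (\<lambda>p. P (snd p)).
             f (fst p) * (f' (fst q) * f'' (snd q) * \<alpha> q) * \<alpha> p)"
      proof (rule sum.reindex_bij_witness
          [of _ "\<lambda>((a, z), (b, c)). ((a \<otimes> b, c), (a, b))" "\<lambda>((y, c), (a, b)). ((a, b \<otimes> c), (b, c))"],
          goal_cases)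
        case (5 r)
        then obtain a b c where r: "r = ((a \<otimes> b, c), (a, b))" "a \<in> carrier G" "b \<in> carrier G" "c \<in> carrier G"
          by (auto simp: P_def)
        have "f a * (f' b * f'' c * \<alpha> (b, c)) * \<alpha> (a, b \<otimes> c) =
              f a * f' b * f'' c * (\<alpha> (b, c) * \<alpha> (a, b \<otimes> c))" by (simp add: algebra_simps)
        also have "\<dots> = f a * f' b * \<alpha> (a, b) * f'' c * \<alpha> (a \<otimes> b, c)"
          by (simp add: coc[symmetric] r algebra_simps)
        finally show ?case by (simp add: r)
      qed (auto simp: P_def m_assoc)
      also have "\<dots> = (\<Sum>p \<in> P x. \<Sum>q \<in> P (snd p).
             f (fst p) * (f' (fst q) * f'' (snd q) * \<alpha> q) * \<alpha> p)"
        by (rule sum.Sigma[symmetric]) (auto simp: finP)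
      also have "\<dots> = (f \<otimes>\<^bsub>?A\<^esub> (f' \<otimes>\<^bsub>?A\<^esub> f'')) x"
        using True
        by (auto simp: mult case_prod_beta sum_distrib_left sum_distrib_right P_def intro!: sum.cong)
      finally show ?thesis .
    qed (simp add: mult)
  qed
  have unit_l: "\<one>\<^bsub>?A\<^esub> \<otimes>\<^bsub>?A\<^esub> f = f" if "f \<in> carrier ?A" for f
  proof
    fix x
    show "(\<one>\<^bsub>?A\<^esub> \<otimes>\<^bsub>?A\<^esub> f) x = f x"
    proof (cases "x \<in> carrier G")
      case True
      have "(\<one>\<^bsub>?A\<^esub> \<otimes>\<^bsub>?A\<^esub> f) x = (\<Sum>p \<in> P x. \<one>\<^bsub>?A\<^esub> (fst p) * f (snd p) * \<alpha> p)"
        using True by (simp add: mult case_prod_beta)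
      also have "\<dots> = (\<Sum>p \<in> {(\<one>, x)}. \<one>\<^bsub>?A\<^esub> (fst p) * f (snd p) * \<alpha> p)"
        by (rule sum.mono_neutral_right) (use True finP in \<open>auto simp: P_def unit\<close>)
      finally show ?thesis using True nz[of \<one> \<one>] a1[OF True] by (simp add: unit)
    qed (use that in \<open>auto simp: mult carr\<close>)
  qed
  have unit_r: "f \<otimes>\<^bsub>?A\<^esub> \<one>\<^bsub>?A\<^esub> = f" if "f \<in> carrier ?A" for f
  proof
    fix x
    show "(f \<otimes>\<^bsub>?A\<^esub> \<one>\<^bsub>?A\<^esub>) x = f x"
    proof (cases "x \<in> carrier G")
      case True
      have "(f \<otimes>\<^bsub>?A\<^esub> \<one>\<^bsub>?A\<^esub>) x = (\<Sum>p \<in> P x. f (fst p) * \<one>\<^bsub>?A\<^esub> (snd p) * \<alpha> p)"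
        using True by (simp add: mult case_prod_beta)
      also have "\<dots> = (\<Sum>p \<in> {(x, \<one>)}. f (fst p) * \<one>\<^bsub>?A\<^esub> (snd p) * \<alpha> p)"
        by (rule sum.mono_neutral_right) (use True finP in \<open>auto simp: P_def unit\<close>)
      finally show ?thesis using True nz[of \<one> \<one>] a1[OF True] by (simp add: unit)
    qed (use that in \<open>auto simp: mult carr\<close>)
  qed
  have monoid: "monoid ?A"
    by (rule monoidI) (auto simp: assoc unit_l unit_r, auto simp: mult unit carr)
  show ?thesis
  proof (rule ringI[OF abel monoid])
    fix f f' f''
    show "(f \<oplus>\<^bsub>?A\<^esub> f') \<otimes>\<^bsub>?A\<^esub> f'' = f \<otimes>\<^bsub>?A\<^esub> f'' \<oplus>\<^bsub>?A\<^esub> f' \<otimes>\<^bsub>?A\<^esub> f''"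
      unfolding mult add
      by (rule restrict_ext, simp only: restrict_apply' sum.distrib[symmetric])
         (auto simp: P_def algebra_simps intro!: sum.cong)
    show "f'' \<otimes>\<^bsub>?A\<^esub> (f \<oplus>\<^bsub>?A\<^esub> f') = f'' \<otimes>\<^bsub>?A\<^esub> f \<oplus>\<^bsub>?A\<^esub> f'' \<otimes>\<^bsub>?A\<^esub> f'"
      unfolding mult add
      by (rule restrict_ext, simp only: restrict_apply' sum.distrib[symmetric])
         (auto simp: P_def algebra_simps intro!: sum.cong)
  qed
qed

lemma twisted_ideal_scale:
  assumes "group G" "finite (carrier G)" "\<alpha> \<in> carrier (Z2 G)"
    and "ideal I (twisted_group_algebra G \<alpha>)" "f \<in> I"
  shows "(\<lambda>x \<in> carrier G. z * f x) \<in> I"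
proof -
  let ?A = "twisted_group_algebra G \<alpha>"
  interpret A: ring ?A by (rule twisted_ring) fact+
  interpret I: ideal I ?A by fact
  have f: "f \<in> carrier ?A" using I.Icarr assms by blast
  let ?z = "\<lambda>x \<in> carrier G. z * \<one>\<^bsub>?A\<^esub> x"
  have "?z \<otimes>\<^bsub>?A\<^esub> f = (\<lambda>x \<in> carrier G. z * (\<one>\<^bsub>?A\<^esub> \<otimes>\<^bsub>?A\<^esub> f) x)"
    by (auto simp: twisted_group_algebra_def restrict_def fun_eq_iff sum_distrib_left mult.assoc
             intro!: sum.cong)
  moreover have "?z \<in> carrier ?A" by (auto simp: twisted_group_algebra_def)
  ultimately show ?thesis using I.I_l_closed[OF \<open>f \<in> I\<close>] f by (metis A.l_one)
qed

lemma simple_ring_iso: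
  assumes "h \<in> ring_iso R S" "simple_ring R" "ring S"
  shows "simple_ring S"
proof -
  interpret R: ring R using assms by (simp add: simple_ring_def)
  interpret S: ring S by fact
  interpret h: ring_hom_ring R S h
    using assms by (auto intro!: ring_hom_ringI2 R.ring_axioms S.ring_axioms simp: ring_iso_def)
  have bij: "bij_betw h (carrier R) (carrier S)" using assms(1) by (simp add: ring_iso_def)
  have "\<one>\<^bsub>S\<^esub> \<noteq> \<zero>\<^bsub>S\<^esub>"
  proof
    assume "\<one>\<^bsub>S\<^esub> = \<zero>\<^bsub>S\<^esub>"
    then have "h \<one>\<^bsub>R\<^esub> = h \<zero>\<^bsub>R\<^esub>" by simp
    then have "\<one>\<^bsub>R\<^esub> = \<zero>\<^bsub>R\<^esub>"
      using inj_onD[OF bij_betw_imp_inj_on[OF bij]] by blast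
    then show False using assms(2) by (simp add: simple_ring_def)
  qed
  moreover have "I = {\<zero>\<^bsub>S\<^esub>} \<or> I = carrier S" if I: "ideal I S" for I
  proof -
    interpret I: ideal I S by fact
    let ?J = "{r \<in> carrier R. h r \<in> I}"
    have img: "h ` ?J = I"
    proof (intro equalityI subsetI)
      fix s assume s: "s \<in> I"
      then have "s \<in> h ` carrier R" using bij_betw_imp_surj_on[OF bij] I.Icarr by simp
      then show "s \<in> h ` ?J" using s by auto
    qed auto
    have "ideal ?J R" by (rule h.ideal_vimage[OF I])
    then have "?J = {\<zero>\<^bsub>R\<^esub>} \<or> ?J = carrier R" using assms(2) by (simp add: simple_ring_def)
    then show ?thesis
    proof
      assume "?J = {\<zero>\<^bsub>R\<^esub>}"
      then show ?thesis using img by force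
    next
      assume "?J = carrier R"
      then show ?thesis using img bij_betw_imp_surj_on[OF bij] by simp
    qed
  qed
  ultimately show ?thesis using assms(3) by (simp add: simple_ring_def)
qed

lemma twisted_simple_coboundary:
  fixes G (structure)
  assumes "group G" "finite (carrier G)" "\<alpha> \<in> carrier (Z2 G)" "\<beta> \<in> B2 G"
    and "simple_ring (twisted_group_algebra G (\<beta> \<otimes>\<^bsub>Z2 G\<^esub> \<alpha>))"
  shows "simple_ring (twisted_group_algebra G \<alpha>)"
proof -
  interpret group G by fact
  obtain c where \<beta>: "\<beta> = coboundary G c" and c: "c \<in> carrier G \<rightarrow> UNIV - {0}"
    using assms by (auto simp: B2_def)
  have nz: "c x \<noteq> 0" if "x \<in> carrier G" for x using c that by auto
  let ?\<gamma> = "\<beta> \<otimes>\<^bsub>Z2 G\<^esub> \<alpha>"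
  let ?R = "twisted_group_algebra G ?\<gamma>" and ?S = "twisted_group_algebra G \<alpha>"
  have \<gamma>: "?\<gamma> (x, y) = c x * c y / c (x \<otimes> y) * \<alpha> (x, y)"
    if "x \<in> carrier G" "y \<in> carrier G" for x y
    using that by (simp add: Z2_def \<beta> coboundary_def)
  have \<alpha>1: "\<alpha> (\<one>, \<one>) \<noteq> 0"
    using assms(3) by (auto simp: Z2_def PiE_def Pi_def)
  let ?h = "\<lambda>f. \<lambda>x \<in> carrier G. c x * f x"
  have "?h \<in> ring_hom ?R ?S"
  proof (rule ring_hom_memI)
    show "?h f \<in> carrier ?S" for f by (auto simp: twisted_group_algebra_def)
    show "?h (f \<oplus>\<^bsub>?R\<^esub> f') = ?h f \<oplus>\<^bsub>?S\<^esub> ?h f'" for f f'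
      by (auto simp: twisted_group_algebra_def restrict_def fun_eq_iff algebra_simps)
    show "?h \<one>\<^bsub>?R\<^esub> = \<one>\<^bsub>?S\<^esub>"
      using nz \<alpha>1 by (auto simp: twisted_group_algebra_def restrict_def fun_eq_iff \<gamma> field_simps)
    show "?h (f \<otimes>\<^bsub>?R\<^esub> f') = ?h f \<otimes>\<^bsub>?S\<^esub> ?h f'" for f f'
      using nz by (auto simp: twisted_group_algebra_def restrict_def fun_eq_iff \<gamma> sum_distrib_left
                   intro!: sum.cong)
  qed
  moreover have "bij_betw ?h (carrier ?R) (carrier ?S)"
    by (rule bij_betw_byWitness[where f' = "\<lambda>f. \<lambda>x \<in> carrier G. f x / c x"])
       (use nz in \<open>auto simp: twisted_group_algebra_def fun_eq_iff restrict_def PiE_def extensional_def\<close>)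
  ultimately have "?h \<in> ring_iso ?R ?S" by (simp add: ring_iso_def)
  then show ?thesis
    using simple_ring_iso assms twisted_ring by blast
qed

lemma nondegenerate_iff:
  assumes "group G" "finite (carrier G)" "\<alpha> \<in> carrier (Z2 G)"
  shows "nondegenerate G (cohomology_class G \<alpha>) \<longleftrightarrow> simple_ring (twisted_group_algebra G \<alpha>)"
proof
  assume "nondegenerate G (cohomology_class G \<alpha>)"
  then obtain \<beta> where "\<beta> \<in> B2 G" "simple_ring (twisted_group_algebra G (\<beta> \<otimes>\<^bsub>Z2 G\<^esub> \<alpha>))"
    by (auto simp: nondegenerate_def cohomology_class_def r_coset_def)
  then show "simple_ring (twisted_group_algebra G \<alpha>)"
    using twisted_simple_coboundary assms by blast
next
  assume *: "simple_ring (twisted_group_algebra G \<alpha>)"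
  interpret Z: comm_group "Z2 G" by (rule Z2_comm_group) fact
  have "\<alpha> \<in> cohomology_class G \<alpha>"
    unfolding cohomology_class_def
    by (rule Z.rcos_self) (use B2_normal assms normal_imp_subgroup in auto)
  then show "nondegenerate G (cohomology_class G \<alpha>)"
    using * by (auto simp: nondegenerate_def)
qed

end

theory Submission
  imports Defs "Jordan_Normal_Form.Spectral_Radius"
begin

text \<open>
  Simplicity of the twisted group algebra is equivalent to the absence of nontrivial
  \<open>\<alpha>\<close>-regular elements: for every \<open>n \<noteq> \<one>\<close> some \<open>c\<close> commutes with \<open>n\<close> while \<open>u c\<close> and \<open>u n\<close> do not
  commute. Indeed, averaging over conjugation by the basis units maps an \<open>\<alpha>\<close>-regular \<open>u n\<close> to a
  nonzero central element, which must be scalar since it has an eigenvalue; conversely, without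
  regular elements the average of \<open>z\<close> is a scalar multiple of the unit, with factor proportional to
  the coefficient of \<open>z\<close> at \<open>\<one>\<close>, so every nonzero ideal contains the unit.

  When \<open>N\<close> satisfies the criterion, a Skolem--Noether type argument shows that each coset \<open>S\<close> of
  \<open>N\<close> supports an invertible element \<open>v S\<close> centralizing the subalgebra of \<open>N\<close>, unique up to scalars.
  Hence \<open>v S \<star> v T = \<beta> (S, T) v (S T)\<close> for a cocycle \<open>\<beta>\<close> of the quotient. Every \<open>u c\<close> is \<open>v (N c)\<close>
  times an element of the subalgebra of \<open>N\<close>, so if \<open>v S\<close> commuted with all \<open>v T\<close> for which \<open>T\<close>
  commutes with \<open>S\<close>, any \<open>y\<close> in the support of \<open>v S\<close> would be \<open>\<alpha>\<close>-regular in \<open>G\<close>.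
\<close>

section \<open>Basis and scalars of the twisted group algebra\<close>

locale twisted_algebra = group G for G (structure) +
  fixes \<alpha> :: "'a \<times> 'a \<Rightarrow> complex"
  assumes finite_carrier: "finite (carrier G)"
    and cocycle: "\<alpha> \<in> carrier (Z2 G)"
begin

abbreviation A :: "('a \<Rightarrow> complex) ring" where "A \<equiv> twisted_group_algebra G \<alpha>"

abbreviation conv :: "('a \<Rightarrow> complex) \<Rightarrow> ('a \<Rightarrow> complex) \<Rightarrow> 'a \<Rightarrow> complex" (infixl "\<star>" 70)
  where "f \<star> f' \<equiv> f \<otimes>\<^bsub>A\<^esub> f'"

sublocale A: ring A
  by (rule twisted_ring) (use is_group finite_carrier cocycle in auto)

definition smult :: "complex \<Rightarrow> ('a \<Rightarrow> complex) \<Rightarrow> 'a \<Rightarrow> complex" where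
  "smult c f = (\<lambda>x \<in> carrier G. c * f x)"

definition u :: "'a \<Rightarrow> 'a \<Rightarrow> complex" where
  "u g = (\<lambda>x \<in> carrier G. if x = g then 1 else 0)"

lemma inv_cancel [simp]:
  assumes "g \<in> carrier G" "x \<in> carrier G"
  shows "g \<otimes> (inv g \<otimes> x) = x" "inv g \<otimes> (g \<otimes> x) = x"
  using assms by (simp_all add: m_assoc[symmetric])

lemma cocycle_nonzero: "g \<in> carrier G \<Longrightarrow> h \<in> carrier G \<Longrightarrow> \<alpha> (g, h) \<noteq> 0"
  using cocycle by (auto simp: Z2_def PiE_def Pi_def)

lemma cocycle_eq:
  "g \<in> carrier G \<Longrightarrow> h \<in> carrier G \<Longrightarrow> k \<in> carrier G \<Longrightarrow>
    \<alpha> (g, h) * \<alpha> (g \<otimes> h, k) = \<alpha> (h, k) * \<alpha> (g, h \<otimes> k)"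
  using cocycle by (auto simp: Z2_def)

text \<open>The cocycle identity with two arguments equal to \<open>\<one>\<close>, followed by
  cancelling a nonzero value. Cocycles are not normalized, so the common value need not be
  1.\<close>

lemma cocycle_one:
  assumes "x \<in> carrier G"
  shows "\<alpha> (\<one>, x) = \<alpha> (\<one>, \<one>)" "\<alpha> (x, \<one>) = \<alpha> (\<one>, \<one>)"
  using cocycle_eq[of \<one> \<one> x] cocycle_eq[of x \<one> \<one>] assms cocycle_nonzero by auto

lemma cocycle_inv: "g \<in> carrier G \<Longrightarrow> \<alpha> (g, inv g) = \<alpha> (inv g, g)"
  using cocycle_eq[of g "inv g" g] cocycle_one[of g] cocycle_nonzero[of \<one> \<one>] by simp

lemma carrier_A: "carrier A = carrier G \<rightarrow>\<^sub>E UNIV"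
  by (simp add: twisted_group_algebra_def)

lemma zero_A: "\<zero>\<^bsub>A\<^esub> = (\<lambda>x \<in> carrier G. 0)"
  by (simp add: twisted_group_algebra_def)

lemma one_A: "\<one>\<^bsub>A\<^esub> = smult (inverse (\<alpha> (\<one>, \<one>))) (u \<one>)"
  by (auto simp: twisted_group_algebra_def smult_def u_def restrict_def fun_eq_iff)

lemma one_neq_zero: "\<one>\<^bsub>A\<^esub> \<noteq> \<zero>\<^bsub>A\<^esub>"
proof -
  have "\<one>\<^bsub>A\<^esub> \<one> \<noteq> \<zero>\<^bsub>A\<^esub> \<one>"
    using cocycle_nonzero[of \<one> \<one>] by (simp add: one_A zero_A smult_def u_def)
  then show ?thesis by metis
qed

lemma A_eqI:
  assumes "f \<in> carrier A" "f' \<in> carrier A" "\<And>x. x \<in> carrier G \<Longrightarrow> f x = f' x"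
  shows "f = f'"
  using assms by (auto simp: carrier_A intro: PiE_ext)

lemma A_nonzeroE:
  assumes "f \<in> carrier A" "f \<noteq> \<zero>\<^bsub>A\<^esub>"
  obtains x where "x \<in> carrier G" "f x \<noteq> 0"
  using A_eqI[OF assms(1) A.zero_closed] assms(2) that by (fastforce simp: zero_A)

lemma u_closed [simp]: "u g \<in> carrier A"
  by (simp add: u_def carrier_A)

lemma smult_closed [simp]: "smult c f \<in> carrier A"
  by (simp add: smult_def carrier_A)

lemma smult_smult: "smult c (smult d f) = smult (c * d) f"
  by (auto simp: smult_def restrict_def fun_eq_iff)

lemma smult_1: "f \<in> carrier A \<Longrightarrow> smult 1 f = f"
  by (auto simp: smult_def carrier_A restrict_def PiE_def extensional_def fun_eq_iff)

lemma smult_0: "smult 0 f = \<zero>\<^bsub>A\<^esub>"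
  by (auto simp: smult_def zero_A)

lemma smult_right_cancel:
  assumes "smult c f = smult d f" "f \<in> carrier A" "f \<noteq> \<zero>\<^bsub>A\<^esub>"
  shows "c = d"
proof -
  obtain x where "x \<in> carrier G" "f x \<noteq> 0" using A_nonzeroE[OF assms(2,3)] .
  then show ?thesis using fun_cong[OF assms(1), of x] by (simp add: smult_def)
qed

lemma conv_apply:
  assumes "x \<in> carrier G"
  shows "(f \<star> f') x = (\<Sum>g \<in> carrier G. f g * f' (inv g \<otimes> x) * \<alpha> (g, inv g \<otimes> x))"
proof -
  have "(f \<star> f') x =
      (\<Sum>(g, h) \<in> {(g, h). g \<in> carrier G \<and> h \<in> carrier G \<and> g \<otimes> h = x}. f g * f' h * \<alpha> (g, h))"
    using assms by (simp add: twisted_group_algebra_def)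
  also have "\<dots> = (\<Sum>g \<in> carrier G. f g * f' (inv g \<otimes> x) * \<alpha> (g, inv g \<otimes> x))"
    by (rule sum.reindex_bij_witness[of _ "\<lambda>g. (g, inv g \<otimes> x)" fst])
       (use assms in auto)
  finally show ?thesis .
qed

lemma u_conv:
  assumes "g \<in> carrier G" "x \<in> carrier G"
  shows "(u g \<star> f) (g \<otimes> x) = \<alpha> (g, x) * f x"
proof -
  have "(u g \<star> f) (g \<otimes> x) =
      (\<Sum>a \<in> carrier G. if a = g then \<alpha> (g, x) * f x else 0)"
    using assms by (subst conv_apply) (auto simp: u_def intro!: sum.cong)
  then show ?thesis using assms finite_carrier by simp
qed

lemma conv_u:
  assumes "g \<in> carrier G" "x \<in> carrier G"
  shows "(f \<star> u g) (x \<otimes> g) = f x * \<alpha> (x, g)"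
proof -
  have "inv a \<otimes> (x \<otimes> g) = g \<longleftrightarrow> a = x" if "a \<in> carrier G" for a
    using that assms by (metis inv_solve_left inv_solve_right' m_closed r_cancel)
  then have "(f \<star> u g) (x \<otimes> g) =
      (\<Sum>a \<in> carrier G. if a = x then f x * \<alpha> (x, g) else 0)"
    using assms by (subst conv_apply) (auto simp: u_def intro!: sum.cong)
  then show ?thesis using assms finite_carrier by simp
qed

lemma u_conv_apply: "g \<in> carrier G \<Longrightarrow> x \<in> carrier G \<Longrightarrow>
    (u g \<star> f) x = \<alpha> (g, inv g \<otimes> x) * f (inv g \<otimes> x)"
  using u_conv[of g "inv g \<otimes> x" f] by simp

lemma conv_sum_u_left: "x \<in> carrier G \<Longrightarrow> (f \<star> f') x = (\<Sum>g \<in> carrier G. f g * (u g \<star> f') x)"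
  by (simp add: conv_apply[of x f] u_conv_apply mult_ac)

lemma conv_sum_u_right:
  assumes "x \<in> carrier G"
  shows "(f \<star> f') x = (\<Sum>h \<in> carrier G. f' h * (f \<star> u h) x)"
proof -
  have "(f \<star> u h) x = f (x \<otimes> inv h) * \<alpha> (x \<otimes> inv h, h)" if "h \<in> carrier G" for h
    using conv_u[of h "x \<otimes> inv h" f] that assms by (simp add: m_assoc)
  then have "(\<Sum>h \<in> carrier G. f' h * (f \<star> u h) x) =
      (\<Sum>h \<in> carrier G. f (x \<otimes> inv h) * f' h * \<alpha> (x \<otimes> inv h, h))"
    by (simp add: mult_ac)
  also have "\<dots> = (f \<star> f') x"
    unfolding conv_apply[OF assms]
    by (rule sum.reindex_bij_witness[of _ "\<lambda>g. inv g \<otimes> x" "\<lambda>h. x \<otimes> inv h"])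
       (use assms in \<open>auto simp: m_assoc inv_mult_group\<close>)
  finally show ?thesis by simp
qed

lemma smult_conv: "smult c f \<star> f' = smult c (f \<star> f')"
  by (auto simp: twisted_group_algebra_def smult_def restrict_def fun_eq_iff sum_distrib_left mult_ac
      intro!: sum.cong)

lemma conv_smult: "f \<star> smult c f' = smult c (f \<star> f')"
  by (auto simp: twisted_group_algebra_def smult_def restrict_def fun_eq_iff sum_distrib_left mult_ac
      intro!: sum.cong)

lemma u_conv_u:
  assumes "g \<in> carrier G" "h \<in> carrier G"
  shows "u g \<star> u h = smult (\<alpha> (g, h)) (u (g \<otimes> h))"
proof (rule A_eqI)
  fix x assume x: "x \<in> carrier G"
  have "(u g \<star> u h) x = \<alpha> (g, inv g \<otimes> x) * u h (inv g \<otimes> x)"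
    using assms(1) x by (rule u_conv_apply)
  then show "(u g \<star> u h) x = smult (\<alpha> (g, h)) (u (g \<otimes> h)) x"
    using assms x by (auto simp: smult_def u_def inv_solve_left)
qed auto

lemma u_Units [simp]:
  assumes "g \<in> carrier G"
  shows "u g \<in> Units A"
proof -
  \<comment> \<open>\<open>u g \<star> u (inv g)\<close> is \<open>\<alpha> (g, inv g)\<close> times
    \<open>u \<one>\<close>, and the unit of \<open>A\<close> is \<open>u \<one>\<close> divided by
    \<open>\<alpha> (\<one>, \<one>)\<close>; hence the scalar. \<open>cocycle_inv\<close> makes the
    inverse two-sided.\<close>
  let ?w = "smult (inverse (\<alpha> (g, inv g) * \<alpha> (\<one>, \<one>))) (u (inv g))"
  have "\<alpha> (g, inv g) \<noteq> 0" "\<alpha> (\<one>, \<one>) \<noteq> 0" using assms cocycle_nonzero by auto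
  then have "u g \<star> ?w = \<one>\<^bsub>A\<^esub>" "?w \<star> u g = \<one>\<^bsub>A\<^esub>"
    using assms
    by (auto simp: smult_conv conv_smult u_conv_u smult_smult one_A cocycle_inv field_simps)
  then show ?thesis unfolding Units_def by force
qed

section \<open>Conjugation by basis units\<close>

definition u_conj :: "'a \<Rightarrow> ('a \<Rightarrow> complex) \<Rightarrow> 'a \<Rightarrow> complex" where
  "u_conj h w = u h \<star> w \<star> inv\<^bsub>A\<^esub> (u h)"

lemma u_conj_closed [simp]: "h \<in> carrier G \<Longrightarrow> w \<in> carrier A \<Longrightarrow> u_conj h w \<in> carrier A"
  by (simp add: u_conj_def)

lemma u_conj_conv_u: "h \<in> carrier G \<Longrightarrow> w \<in> carrier A \<Longrightarrow> u_conj h w \<star> u h = u h \<star> w"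
  by (simp add: u_conj_def A.m_assoc)

lemma Units_r_cancel:
  assumes "a \<star> z = b \<star> z" "z \<in> Units A" "a \<in> carrier A" "b \<in> carrier A"
  shows "a = b"
  using assms by (metis A.Units_closed A.Units_inv_closed A.Units_r_inv A.m_assoc A.r_one)

lemma u_conj_eqI:
  assumes "a \<star> u h = u h \<star> w" "h \<in> carrier G" "w \<in> carrier A" "a \<in> carrier A"
  shows "a = u_conj h w"
  using assms by (intro Units_r_cancel[of a "u h"]) (auto simp: u_conj_conv_u)

text \<open>Both sides are the coefficient at \<open>y \<otimes> h\<close> in the identity
  \<open>u_conj h w \<star> u h = u h \<star> w\<close>.\<close>

lemma u_conj_apply:
  assumes "h \<in> carrier G" "y \<in> carrier G" "w \<in> carrier A"
  shows "u_conj h w y * \<alpha> (y, h) = \<alpha> (h, inv h \<otimes> y \<otimes> h) * w (inv h \<otimes> y \<otimes> h)"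
proof -
  have "u_conj h w y * \<alpha> (y, h) = (u h \<star> w) (y \<otimes> h)"
    using assms by (simp add: u_conj_conv_u flip: conv_u)
  also have "\<dots> = (u h \<star> w) (h \<otimes> (inv h \<otimes> y \<otimes> h))"
    using assms by (simp add: m_assoc)
  also have "\<dots> = \<alpha> (h, inv h \<otimes> y \<otimes> h) * w (inv h \<otimes> y \<otimes> h)"
    using assms by (simp add: u_conv)
  finally show ?thesis .
qed

lemma u_conj_apply_one:
  assumes "h \<in> carrier G" "w \<in> carrier A"
  shows "u_conj h w \<one> = w \<one>"
  using u_conj_apply[OF assms(1) one_closed assms(2)] assms cocycle_one[of h] cocycle_nonzero[of \<one> \<one>]
  by simp

text \<open>Conjugation by \<open>u h\<close> permutes the lines spanned by the basis, so a diagonal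
  entry survives only when \<open>h\<close> and \<open>y\<close> commute; it is then the commutator
  scalar of \<open>u h\<close> and \<open>u y\<close>.\<close>

lemma u_conj_u_apply:
  assumes "h \<in> carrier G" "y \<in> carrier G"
  shows "u_conj h (u y) y = (if h \<otimes> y = y \<otimes> h then \<alpha> (h, y) / \<alpha> (y, h) else 0)"
proof -
  have "inv h \<otimes> y \<otimes> h = y \<longleftrightarrow> h \<otimes> y = y \<otimes> h"
    using assms by (metis inv_solve_left m_assoc inv_closed m_closed)
  then show ?thesis
    using u_conj_apply[OF assms u_closed, of y] assms cocycle_nonzero[of y h]
    by (auto simp: u_def field_simps)
qed

text \<open>\<open>u (k \<otimes> h)\<close> and \<open>u k \<star> u h\<close> differ by a scalar,
  which conjugation does not see: the conjugations form an action of \<open>G\<close>. The factor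
  \<open>u k\<close> on the right keeps inverses out.\<close>

lemma u_conj_conj:
  assumes "k \<in> carrier G" "h \<in> carrier G" "w \<in> carrier A"
  shows "u_conj (k \<otimes> h) w \<star> u k = u k \<star> u_conj h w"
proof (rule Units_r_cancel)
  have "smult (\<alpha> (k, h)) (u_conj (k \<otimes> h) w \<star> u (k \<otimes> h)) = smult (\<alpha> (k, h)) (u (k \<otimes> h) \<star> w)"
    using assms by (simp add: u_conj_conv_u)
  then have "u_conj (k \<otimes> h) w \<star> (u k \<star> u h) = (u k \<star> u h) \<star> w"
    using assms by (simp add: u_conv_u smult_conv conv_smult)
  then show "u_conj (k \<otimes> h) w \<star> u k \<star> u h = u k \<star> u_conj h w \<star> u h"
    using assms by (simp add: A.m_assoc u_conj_conv_u)
qed (use assms in auto)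

lemma finsum_apply:
  assumes "finite S" "\<And>i. i \<in> S \<Longrightarrow> f i \<in> carrier A" "x \<in> carrier G"
  shows "(\<Oplus>\<^bsub>A\<^esub>i \<in> S. f i) x = (\<Sum>i \<in> S. f i x)"
  using assms
proof (induction S)
  case empty
  then show ?case by (simp add: zero_A)
next
  case (insert i S)
  then have "(\<Oplus>\<^bsub>A\<^esub>i \<in> insert i S. f i) = f i \<oplus>\<^bsub>A\<^esub> (\<Oplus>\<^bsub>A\<^esub>i \<in> S. f i)"
    by (intro A.finsum_insert) auto
  moreover have "(f i \<oplus>\<^bsub>A\<^esub> (\<Oplus>\<^bsub>A\<^esub>i \<in> S. f i)) x = f i x + (\<Oplus>\<^bsub>A\<^esub>i \<in> S. f i) x"
    using insert.prems by (simp add: twisted_group_algebra_def)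
  ultimately show ?case using insert by simp
qed

text \<open>No nontrivial element of \<open>N\<close> is \<alpha>-regular within \<open>N\<close>.
  The set argument lets the condition for a subgroup be used inside the algebra of the whole
  group.\<close>

definition separating :: "'a set \<Rightarrow> bool" where
  "separating N \<longleftrightarrow>
    (\<forall>n \<in> N - {\<one>}. \<exists>c \<in> N. c \<otimes> n = n \<otimes> c \<and> \<alpha> (c, n) \<noteq> \<alpha> (n, c))"

lemma u_conj_conv_commute:
  assumes "v \<star> u h = u h \<star> v" "h \<in> carrier G" "v \<in> carrier A" "w \<in> carrier A"
  shows "u_conj h (v \<star> w) = v \<star> u_conj h w"
proof -
  have "v \<star> u_conj h w \<star> u h = u h \<star> (v \<star> w)"
    using assms by (metis A.m_assoc A.Units_closed u_conj_closed u_conj_conv_u u_Units)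
  then show ?thesis
    using assms by (metis A.m_closed u_conj_closed u_conj_eqI)
qed

lemma inv_u_apply:
  assumes "g \<in> carrier G" "x \<in> carrier G" "(inv\<^bsub>A\<^esub> (u g)) x \<noteq> 0"
  shows "x = inv g"
proof -
  have "\<one>\<^bsub>A\<^esub> (x \<otimes> g) = (inv\<^bsub>A\<^esub> (u g)) x * \<alpha> (x, g)"
    using assms conv_u[of g x "inv\<^bsub>A\<^esub> (u g)"] by simp
  then have "\<one>\<^bsub>A\<^esub> (x \<otimes> g) \<noteq> 0" using assms cocycle_nonzero by simp
  then have "x \<otimes> g = \<one>" using assms by (auto simp: one_A smult_def u_def split: if_splits)
  then show ?thesis using assms by (simp add: inv_equality)
qed

lemma conv_supportE:
  assumes "(f \<star> f') x \<noteq> 0" "x \<in> carrier G"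
  obtains g h where "g \<in> carrier G" "h \<in> carrier G" "x = g \<otimes> h" "f g \<noteq> 0" "f' h \<noteq> 0"
proof -
  obtain g where g: "g \<in> carrier G" "f g * f' (inv g \<otimes> x) * \<alpha> (g, inv g \<otimes> x) \<noteq> 0"
    using assms by (auto simp: conv_apply elim!: sum.not_neutral_contains_not_neutral)
  then show ?thesis using that[of g "inv g \<otimes> x"] assms(2) by auto
qed

section \<open>Averages and centralizers\<close>

text \<open>Not divided by \<open>card N\<close>, which therefore reappears as a factor in the
  coefficient at \<open>\<one>\<close>.\<close>

definition average :: "'a set \<Rightarrow> ('a \<Rightarrow> complex) \<Rightarrow> 'a \<Rightarrow> complex" where
  "average N w = (\<Oplus>\<^bsub>A\<^esub>h \<in> N. u_conj h w)"

text \<open>For a coset \<open>S\<close> of \<open>N\<close>, the part of degree \<open>S\<close> of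
  the centralizer of the subalgebra of \<open>N\<close>. Commuting with basis elements suffices by
  linearity, see \<open>centralizer_commute\<close>.\<close>

definition centralizer :: "'a set \<Rightarrow> 'a set \<Rightarrow> ('a \<Rightarrow> complex) set" where
  "centralizer N S = {v \<in> carrier A. (\<forall>x \<in> carrier G. v x \<noteq> 0 \<longrightarrow> x \<in> S) \<and>
     (\<forall>h \<in> N. v \<star> u h = u h \<star> v)}"

lemma centralizerD:
  assumes "v \<in> centralizer N S"
  shows "v \<in> carrier A" "x \<in> carrier G \<Longrightarrow> v x \<noteq> 0 \<Longrightarrow> x \<in> S"
    and "h \<in> N \<Longrightarrow> v \<star> u h = u h \<star> v"
  using assms by (auto simp: centralizer_def)

lemma smult_centralizer: "v \<in> centralizer N S \<Longrightarrow> smult c v \<in> centralizer N S"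
  by (auto simp: centralizer_def smult_conv conv_smult) (auto simp: smult_def)

lemma centralizer_conv:
  assumes "v \<in> centralizer N S" "w \<in> centralizer N T" "N \<subseteq> carrier G"
  shows "v \<star> w \<in> centralizer N (S <#> T)"
proof -
  note v = centralizerD[OF assms(1)] and w = centralizerD[OF assms(2)]
  have "v \<star> w \<star> u h = u h \<star> (v \<star> w)" if "h \<in> N" for h
    using that v(1,3) w(1,3) by (metis A.m_assoc u_closed)
  moreover have "x \<in> S <#> T" if x: "x \<in> carrier G" "(v \<star> w) x \<noteq> 0" for x
  proof -
    obtain g h where "g \<in> carrier G" "h \<in> carrier G" "x = g \<otimes> h" "v g \<noteq> 0" "w h \<noteq> 0"
      using conv_supportE[OF x(2,1)] by blast
    then show ?thesis using v(2) w(2) unfolding set_mult_def by blast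
  qed
  ultimately show ?thesis using v(1) w(1) by (auto simp: centralizer_def)
qed

text \<open>By bilinearity, as \<open>b\<close> is a linear combination of the \<open>u g\<close>
  with \<open>g \<in> N\<close>.\<close>

lemma centralizer_commute:
  assumes "v \<in> centralizer N S" "b \<in> carrier A" "\<And>x. x \<in> carrier G \<Longrightarrow> b x \<noteq> 0 \<Longrightarrow> x \<in> N"
  shows "b \<star> v = v \<star> b"
proof (rule A_eqI)
  fix x assume x: "x \<in> carrier G"
  have "b g * (u g \<star> v) x = b g * (v \<star> u g) x" if "g \<in> carrier G" for g
    using assms(3)[OF that] centralizerD(3)[OF assms(1)] by (cases "b g = 0") auto
  then show "(b \<star> v) x = (v \<star> b) x"
    using sum.cong[OF refl, of "carrier G" "\<lambda>g. b g * (u g \<star> v) x" "\<lambda>g. b g * (v \<star> u g) x"]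
    by (simp add: conv_sum_u_left[OF x, of b v] conv_sum_u_right[OF x, of v b])
qed (use assms centralizerD(1) in auto)

lemma commute_u_apply:
  assumes "v \<star> u h = u h \<star> v" "h \<in> carrier G" "y \<in> carrier G" "h \<otimes> y = y \<otimes> h" "v y \<noteq> 0"
  shows "\<alpha> (h, y) = \<alpha> (y, h)"
proof -
  have "\<alpha> (h, y) * v y = v y * \<alpha> (y, h)"
    using u_conv[OF assms(2,3), of v] conv_u[OF assms(2,3), of v] assms(1,4) by simp
  then show ?thesis using assms(5) by simp
qed

text \<open>If the support of \<open>v\<close> contained some \<open>x \<noteq> \<one>\<close>, the
  \<open>c\<close> that \<open>separating N\<close> gives for \<open>x\<close> would contradict
  \<open>commute_u_apply\<close>. The factor \<open>\<alpha> (\<one>, \<one>)\<close> undoes the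
  scalar in the unit of \<open>A\<close>.\<close>

lemma centralizer_scalar:
  assumes "separating N" "subgroup N G" "v \<in> centralizer N N"
  shows "v = smult (v \<one> * \<alpha> (\<one>, \<one>)) \<one>\<^bsub>A\<^esub>"
proof (rule A_eqI)
  fix x assume x: "x \<in> carrier G"
  have "v x = 0" if x1: "x \<noteq> \<one>"
  proof (rule ccontr)
    assume nz: "v x \<noteq> 0"
    then have "x \<in> N" using centralizerD(2)[OF assms(3) x] by blast
    then obtain c where "c \<in> N" "c \<otimes> x = x \<otimes> c" "\<alpha> (c, x) \<noteq> \<alpha> (x, c)"
      using assms(1) x1 unfolding separating_def by blast
    then show False
      using commute_u_apply[OF centralizerD(3)[OF assms(3)]] x nz subgroup.subset[OF assms(2)]
      by blast
  qed
  then show "v x = smult (v \<one> * \<alpha> (\<one>, \<one>)) \<one>\<^bsub>A\<^esub> x"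
    using x cocycle_nonzero[of \<one> \<one>] by (auto simp: one_A smult_def u_def)
qed (use assms centralizerD(1) in auto)

text \<open>The ratio is the scalar by which conjugation by \<open>u h\<close> multiplies a basis
  element of the centralizer of \<open>h\<close>. Conjugation is multiplicative, so the ratio is a
  character of that centralizer; three instances of the cocycle identity verify this
  directly.\<close>

lemma commutator_ratio_mult:
  assumes G: "h \<in> carrier G" "c \<in> carrier G" "y \<in> carrier G"
    and "h \<otimes> c = c \<otimes> h" "h \<otimes> y = y \<otimes> h"
  shows "\<alpha> (h, c \<otimes> y) / \<alpha> (c \<otimes> y, h) = \<alpha> (h, c) / \<alpha> (c, h) * (\<alpha> (h, y) / \<alpha> (y, h))"
proof -
  have e1: "\<alpha> (h, c) * \<alpha> (c \<otimes> h, y) = \<alpha> (c, y) * \<alpha> (h, c \<otimes> y)"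
    using cocycle_eq[of h c y] assms by simp
  have e2: "\<alpha> (c, y) * \<alpha> (c \<otimes> y, h) = \<alpha> (y, h) * \<alpha> (c, h \<otimes> y)"
    using cocycle_eq[of c y h] assms by simp
  have e3: "\<alpha> (c, h) * \<alpha> (c \<otimes> h, y) = \<alpha> (h, y) * \<alpha> (c, h \<otimes> y)"
    using cocycle_eq[of c h y] assms by simp
  have "\<alpha> (c, y) * (\<alpha> (h, c \<otimes> y) * \<alpha> (c, h) * \<alpha> (y, h)) =
      \<alpha> (h, c) * \<alpha> (y, h) * (\<alpha> (c, h) * \<alpha> (c \<otimes> h, y))"
    using e1 by (simp add: algebra_simps)
  also have "\<dots> = \<alpha> (c, y) * (\<alpha> (h, c) * \<alpha> (h, y) * \<alpha> (c \<otimes> y, h))"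
    using e2 unfolding e3 by (simp add: algebra_simps)
  finally have "\<alpha> (h, c \<otimes> y) * \<alpha> (c, h) * \<alpha> (y, h) = \<alpha> (h, c) * \<alpha> (h, y) * \<alpha> (c \<otimes> y, h)"
    using cocycle_nonzero[of c y] G by simp
  then show ?thesis using G by (simp add: field_simps cocycle_nonzero)
qed

text \<open>Multiplying back by \<open>u y\<close> recovers \<open>w\<close>. This moves a chosen
  nonzero coefficient to \<open>\<one>\<close>, where averaging changes it only by the factor
  \<open>card N\<close>.\<close>

lemma conv_inv_u_apply_one:
  assumes "w \<in> carrier A" "y \<in> carrier G" "w y \<noteq> 0"
  shows "(w \<star> inv\<^bsub>A\<^esub> (u y)) \<one> \<noteq> 0"
proof -
  have "(w \<star> inv\<^bsub>A\<^esub> (u y) \<star> u y) y = (w \<star> inv\<^bsub>A\<^esub> (u y)) \<one> * \<alpha> (\<one>, y)"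
    using conv_u[of y \<one> "w \<star> inv\<^bsub>A\<^esub> (u y)"] assms(2) by simp
  moreover have "w \<star> inv\<^bsub>A\<^esub> (u y) \<star> u y = w"
    using assms(1,2) by (simp add: A.m_assoc)
  ultimately show ?thesis using assms(3) by auto
qed

section \<open>Averaging over a normal subgroup\<close>

context
  fixes N assumes N: "N \<lhd> G"
begin

lemma normal_subset: "N \<subseteq> carrier G"
  using N by (simp add: normal_imp_subgroup subgroup.subset)

lemma coset_conj_closed:
  assumes "S \<in> rcosets N" "h \<in> N" "y \<in> carrier G" "inv h \<otimes> y \<otimes> h \<in> S"
  shows "y \<in> S"
proof -
  interpret N: normal N G by (rule N)
  have h: "h \<in> carrier G" using assms normal_subset by blast
  define z where "z = inv h \<otimes> y \<otimes> h"
  have z: "z \<in> carrier G" "z \<in> S" using assms h by (auto simp: z_def)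
  obtain a where a: "a \<in> carrier G" "S = N #> a" using assms by (auto simp: RCOSETS_def)
  then have S: "S = N #> z" using z N.is_subgroup repr_independence by metis
  \<comment> \<open>\<open>y\<close> is the conjugate of \<open>z\<close> by \<open>h\<close>,
    rewritten as an element of \<open>N\<close> times \<open>z\<close>: normality puts the conjugate
    of \<open>inv h\<close> by \<open>z\<close> into \<open>N\<close>.\<close>
  have "y = (h \<otimes> (z \<otimes> inv h \<otimes> inv z)) \<otimes> z"
    using h z assms(3) unfolding z_def by (simp add: m_assoc inv_mult_group)
  moreover have "z \<otimes> inv h \<otimes> inv z \<in> N"
    using N.inv_op_closed2 z assms(2) by simp
  ultimately show ?thesis using assms(2) by (auto simp: S r_coset_def)
qed

lemma average_closed [simp]: "w \<in> carrier A \<Longrightarrow> average N w \<in> carrier A"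
  using normal_subset by (auto simp: average_def intro!: A.finsum_closed)

lemma average_apply:
  "w \<in> carrier A \<Longrightarrow> x \<in> carrier G \<Longrightarrow> average N w x = (\<Sum>h \<in> N. u_conj h w x)"
  unfolding average_def
  by (rule finsum_apply) (use normal_subset finite_carrier in \<open>auto intro: finite_subset\<close>)

lemma average_apply_one:
  "w \<in> carrier A \<Longrightarrow> average N w \<one> = of_nat (card N) * w \<one>"
  using normal_subset by (simp add: average_apply u_conj_apply_one subset_iff)

text \<open>Moving \<open>u k\<close> to the left turns conjugation by \<open>k \<otimes> h\<close>
  into conjugation by \<open>h\<close>, and translation by \<open>k\<close> permutes
  \<open>N\<close>.\<close>

lemma average_commute:
  assumes "k \<in> N" "w \<in> carrier A"
  shows "average N w \<star> u k = u k \<star> average N w"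
proof -
  interpret N: normal N G by (rule N)
  have k: "k \<in> carrier G" using assms normal_subset by blast
  have fin: "finite N" using normal_subset finite_carrier finite_subset by blast
  have img: "(\<lambda>h. k \<otimes> h) ` N = N"
  proof (intro equalityI subsetI)
    fix x assume "x \<in> N"
    then show "x \<in> (\<lambda>h. k \<otimes> h) ` N"
      using assms(1) by (intro image_eqI[of _ _ "inv k \<otimes> x"]) auto
  qed (use assms(1) in auto)
  have inj: "inj_on (\<lambda>h. k \<otimes> h) N"
    using assms(1) by (auto intro!: inj_onI)
  have u_conj: "u_conj h w \<in> carrier A" if "h \<in> N" for h using that assms(2) by auto
  have "average N w \<star> u k = (\<Oplus>\<^bsub>A\<^esub>h \<in> N. u_conj h w \<star> u k)"
    unfolding average_def by (rule A.finsum_ldistr) (use fin u_conj in auto)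
  also have "\<dots> = (\<Oplus>\<^bsub>A\<^esub>h \<in> (\<lambda>h. k \<otimes> h) ` N. u_conj h w \<star> u k)"
    unfolding img ..
  also have "\<dots> = (\<Oplus>\<^bsub>A\<^esub>h \<in> N. u_conj (k \<otimes> h) w \<star> u k)"
    by (rule A.finsum_reindex) (use u_conj img inj in auto)
  also have "\<dots> = (\<Oplus>\<^bsub>A\<^esub>h \<in> N. u k \<star> u_conj h w)"
    by (rule A.finsum_cong') (use u_conj u_conj_conj assms k in auto)
  also have "\<dots> = u k \<star> average N w"
    unfolding average_def by (rule A.finsum_rdistr[symmetric]) (use fin u_conj in auto)
  finally show ?thesis .
qed

lemma average_centralizer:
  assumes "S \<in> rcosets N" "w \<in> carrier A" "\<And>x. x \<in> carrier G \<Longrightarrow> w x \<noteq> 0 \<Longrightarrow> x \<in> S"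
  shows "average N w \<in> centralizer N S"
proof -
  have "x \<in> S" if x: "x \<in> carrier G" and nz: "average N w x \<noteq> 0" for x
  proof -
    have "(\<Sum>h \<in> N. u_conj h w x) \<noteq> 0" using nz x assms by (simp add: average_apply)
    then obtain h where h: "h \<in> N" "u_conj h w x \<noteq> 0"
      by (rule sum.not_neutral_contains_not_neutral)
    then have hG: "h \<in> carrier G" using normal_subset by blast
    have "w (inv h \<otimes> x \<otimes> h) \<noteq> 0"
      using u_conj_apply[OF hG x assms(2)] h(2) cocycle_nonzero[OF x hG] by auto
    then have "inv h \<otimes> x \<otimes> h \<in> S" using hG x by (intro assms(3)) auto
    then show ?thesis using coset_conj_closed[OF assms(1) h(1) x] by blast
  qed
  then show ?thesis using average_commute assms by (auto simp: centralizer_def)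
qed

text \<open>Conjugation by \<open>u h\<close> with \<open>h \<in> N\<close> fixes \<open>v\<close>,
  so \<open>v\<close> factors out of every summand.\<close>

lemma average_conv:
  assumes "v \<in> centralizer N S" "w \<in> carrier A"
  shows "average N (v \<star> w) = v \<star> average N w"
proof -
  note v = centralizerD[OF assms(1)]
  have fin: "finite N" using normal_subset finite_carrier finite_subset by blast
  have "average N (v \<star> w) = (\<Oplus>\<^bsub>A\<^esub>h \<in> N. v \<star> u_conj h w)"
    unfolding average_def
    by (rule A.finsum_cong')
       (use v assms(2) normal_subset u_conj_conv_commute in \<open>auto simp: subset_iff\<close>)
  also have "\<dots> = v \<star> average N w"
    unfolding average_def
    by (rule A.finsum_rdistr[symmetric]) (use fin v assms(2) normal_subset in auto)
  finally show ?thesis .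
qed

lemma card_normal_pos: "card N > 0"
proof -
  have "\<one> \<in> N" using N by (simp add: normal_imp_subgroup subgroup.one_closed)
  then show ?thesis using normal_subset finite_carrier finite_subset by (auto simp: card_gt_0_iff)
qed

text \<open>The vanishing argument for character sums: replacing \<open>y\<close> by
  \<open>c \<otimes> y\<close>, with \<open>c\<close> from \<open>separating N\<close>, permutes
  \<open>S\<close> and multiplies every summand by \<open>\<alpha> (h, c) / \<alpha> (c, h)\<close>,
  which is not 1.\<close>

lemma sum_commutator_ratio:
  assumes "separating N" "S \<in> rcosets N" "h \<in> N" "h \<noteq> \<one>"
  shows "(\<Sum>y \<in> S. u_conj h (u y) y) = 0"
proof -
  interpret N: normal N G by (rule N)
  obtain c where c: "c \<in> N" "c \<otimes> h = h \<otimes> c" "\<alpha> (c, h) \<noteq> \<alpha> (h, c)"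
    using assms unfolding separating_def by blast
  have G: "h \<in> carrier G" "c \<in> carrier G" "S \<subseteq> carrier G"
    using c assms normal_subset N.rcosets_carrier[OF is_group] by auto
  obtain a where a: "a \<in> carrier G" "S = N #> a" using assms by (auto simp: RCOSETS_def)
  have S: "n \<otimes> y \<in> S" if "n \<in> N" "y \<in> S" for n y
    using that a N.m_closed normal_subset by (fastforce simp: r_coset_def m_assoc[symmetric])
  have shift: "u_conj h (u (c \<otimes> y)) (c \<otimes> y) = \<alpha> (h, c) / \<alpha> (c, h) * u_conj h (u y) y"
    if "y \<in> S" for y
  proof -
    have y: "y \<in> carrier G" using that G by blast
    have "h \<otimes> (c \<otimes> y) = c \<otimes> (h \<otimes> y)" using G y c(2) by (simp add: m_assoc[symmetric])
    then have "h \<otimes> (c \<otimes> y) = c \<otimes> y \<otimes> h \<longleftrightarrow> h \<otimes> y = y \<otimes> h"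
      using G y by (simp add: m_assoc)
    then show ?thesis
      using G y c(2) by (simp add: u_conj_u_apply commutator_ratio_mult)
  qed
  have "(\<Sum>y \<in> S. u_conj h (u y) y) = (\<Sum>y \<in> S. u_conj h (u (c \<otimes> y)) (c \<otimes> y))"
    by (rule sum.reindex_bij_witness[of _ "\<lambda>y. c \<otimes> y" "\<lambda>y. inv c \<otimes> y"])
       (use c G S in \<open>auto simp: subset_iff\<close>)
  also have "\<dots> = \<alpha> (h, c) / \<alpha> (c, h) * (\<Sum>y \<in> S. u_conj h (u y) y)"
    by (simp add: shift sum_distrib_left)
  finally show ?thesis
    using c(3) cocycle_nonzero[of c h] G by (auto simp: field_simps)
qed

text \<open>Double counting: the coefficients of \<open>average N (u y)\<close> at \<open>y\<close>, for \<open>y \<in> S\<close>, sum up to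
  \<open>card S\<close>, because only the summand of the unit element survives.\<close>

lemma ex_centralizer_nonzero:
  assumes "separating N" "S \<in> rcosets N"
  obtains v y where "v \<in> centralizer N S" "y \<in> carrier G" "v y \<noteq> 0"
proof -
  interpret N: normal N G by (rule N)
  have S: "S \<subseteq> carrier G" using N.rcosets_carrier[OF is_group] assms by blast
  have fin: "finite N" "finite S" using normal_subset S finite_carrier finite_subset by blast+
  have one: "u_conj \<one> (u y) y = 1" if "y \<in> S" for y
  proof -
    have "y \<in> carrier G" using that S by blast
    then show ?thesis
      using cocycle_nonzero[of \<one> \<one>] cocycle_one[of y] by (simp add: u_conj_u_apply)
  qed
  have "(\<Sum>y \<in> S. average N (u y) y) = (\<Sum>y \<in> S. \<Sum>h \<in> N. u_conj h (u y) y)"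
    using S by (intro sum.cong) (auto simp: average_apply)
  also have "\<dots> = (\<Sum>h \<in> N. \<Sum>y \<in> S. u_conj h (u y) y)"
    by (rule sum.swap)
  also have "\<dots> = (\<Sum>h \<in> {\<one>}. \<Sum>y \<in> S. u_conj h (u y) y)"
    by (rule sum.mono_neutral_right) (use fin sum_commutator_ratio assms in auto)
  also have "\<dots> = (\<Sum>y \<in> S. 1)"
    by (simp add: one)
  also have "\<dots> = of_nat (card N)"
    using card_rcosets_equal[OF assms(2) normal_subset] by simp
  finally have "(\<Sum>y \<in> S. average N (u y) y) \<noteq> 0" using card_normal_pos by simp
  then obtain y where y: "y \<in> S" "average N (u y) y \<noteq> 0"
    by (rule sum.not_neutral_contains_not_neutral)
  have "u y x \<noteq> 0 \<Longrightarrow> x \<in> S" if "x \<in> carrier G" for x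
    using y(1) that by (auto simp: u_def split: if_splits)
  then have "average N (u y) \<in> centralizer N S"
    using assms(2) by (intro average_centralizer) auto
  then show thesis using that y(2) S y(1) by blast
qed

lemma rcosets_iff: "S \<in> rcosets N \<longleftrightarrow> S \<in> carrier (G Mod N)"
  by (simp add: FactGroup_def)

text \<open>The average \<open>w\<close> of the inverse of \<open>u y\<close> works up to a scalar:
  \<open>v \<star> w\<close> has degree \<open>N\<close>, hence is a scalar, and it is the average
  of \<open>v\<close> times that inverse, whose coefficient at \<open>\<one>\<close> is nonzero
  because \<open>v y\<close> is.\<close>

lemma centralizer_right_inverse:
  assumes "separating N" "S \<in> rcosets N" "v \<in> centralizer N S" "y \<in> carrier G" "v y \<noteq> 0"
  obtains w where "w \<in> centralizer N (set_inv S)" "v \<star> w = \<one>\<^bsub>A\<^esub>"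
proof -
  interpret N: normal N G by (rule N)
  interpret Q: group "G Mod N" by (rule N.factorgroup_is_group)
  define w where "w = average N (inv\<^bsub>A\<^esub> (u y))"
  define z where "z = v \<star> inv\<^bsub>A\<^esub> (u y)"
  note v = centralizerD[OF assms(3)]
  have iu: "inv\<^bsub>A\<^esub> (u y) \<in> carrier A" using assms(4) by simp
  have y: "y \<in> S" using v(2) assms by blast
  then have "inv y \<in> set_inv S" by (auto simp: SET_INV_def)
  then have w: "w \<in> centralizer N (set_inv S)"
    unfolding w_def using assms(2,4) inv_u_apply iu
    by (intro average_centralizer N.setinv_closed) auto
  have "S <#> set_inv S = N"
    using Q.r_inv[of S] N.inv_FactGroup[of S] assms(2) by (simp add: rcosets_iff)
  then have "v \<star> w \<in> centralizer N N"
    using centralizer_conv[OF assms(3) w normal_subset] by simp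
  from centralizer_scalar[OF assms(1) N.is_subgroup this]
  have vw: "v \<star> w = smult ((v \<star> w) \<one> * \<alpha> (\<one>, \<one>)) \<one>\<^bsub>A\<^esub>" .
  have "v \<star> w = average N z"
    unfolding w_def z_def using average_conv[OF assms(3) iu] by simp
  then have "(v \<star> w) \<one> = of_nat (card N) * z \<one>"
    using v(1) iu by (simp add: average_apply_one z_def)
  moreover have "z \<one> \<noteq> 0" unfolding z_def using v(1) assms by (intro conv_inv_u_apply_one) auto
  ultimately have nz: "(v \<star> w) \<one> * \<alpha> (\<one>, \<one>) \<noteq> 0" (is "?c \<noteq> 0")
    using card_normal_pos cocycle_nonzero[of \<one> \<one>] by simp
  have "v \<star> smult (inverse ?c) w = smult (inverse ?c) (smult ?c \<one>\<^bsub>A\<^esub>)"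
    using vw by (simp only: conv_smult)
  also have "\<dots> = \<one>\<^bsub>A\<^esub>" by (simp only: smult_smult left_inverse[OF nz] smult_1[OF A.one_closed])
  finally show thesis using that smult_centralizer[OF w] by blast
qed

end

section \<open>Simplicity criterion\<close>

text \<open>Left multiplication by \<open>f\<close> is a linear map on a nonzero finite-dimensional
  complex space; \<open>M\<close> is its matrix in the basis \<open>u\<close>, enumerated by
  \<open>e\<close>.\<close>

lemma eigenvector_exists:
  assumes "f \<in> carrier A"
  obtains \<mu> y where "y \<in> carrier A" "y \<noteq> \<zero>\<^bsub>A\<^esub>" "f \<star> y = smult \<mu> y"
proof -
  define n where "n = card (carrier G)"
  obtain e where e: "bij_betw e {0..<n} (carrier G)"
    using ex_bij_betw_nat_finite[OF finite_carrier] by (auto simp: n_def)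
  define M where "M = mat n n (\<lambda>(i, j). (f \<star> u (e j)) (e i))"
  have M: "M \<in> carrier_mat n n" by (simp add: M_def)
  have "n > 0" using finite_carrier by (auto simp: n_def card_gt_0_iff)
  then obtain \<mu> v where v: "v \<in> carrier_vec n" "v \<noteq> 0\<^sub>v n" "M *\<^sub>v v = \<mu> \<cdot>\<^sub>v v"
    using spectrum_non_empty[OF M] M unfolding spectrum_def eigenvalue_def eigenvector_def by auto
  define y where "y = (\<lambda>x \<in> carrier G. v $ the_inv_into {0..<n} e x)"
  have eG: "e i \<in> carrier G" if "i < n" for i using that e by (auto simp: bij_betw_def)
  have y: "y (e i) = v $ i" if "i < n" for i
    using that eG e by (simp add: y_def the_inv_into_f_f bij_betw_def)
  have yA: "y \<in> carrier A" by (simp add: y_def carrier_A)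
  obtain i where "i < n" "v $ i \<noteq> 0" using v(1,2) by (metis carrier_vecD eq_vecI index_zero_vec)
  then have "y \<noteq> \<zero>\<^bsub>A\<^esub>" using y[of i] eG[of i] by (auto simp: zero_A)
  moreover have "f \<star> y = smult \<mu> y"
  proof (rule A_eqI)
    fix x assume x: "x \<in> carrier G"
    then obtain i where i: "i < n" "x = e i"
      using e by (metis atLeastLessThan_iff bij_betw_imp_surj_on imageE)
    have "(f \<star> y) x = (\<Sum>h \<in> carrier G. y h * (f \<star> u h) x)" by (rule conv_sum_u_right[OF x])
    also have "\<dots> = (\<Sum>j \<in> {0..<n}. y (e j) * (f \<star> u (e j)) x)"
      by (rule sum.reindex_bij_betw[OF e, symmetric])
    also have "\<dots> = (\<Sum>j \<in> {0..<n}. M $$ (i, j) * v $ j)"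
      using i by (intro sum.cong) (auto simp: M_def y)
    also have "\<dots> = (M *\<^sub>v v) $ i"
      using M v(1) i by (simp add: scalar_prod_def)
    also have "\<dots> = smult \<mu> y x" using v(1,3) i x by (simp add: smult_def y)
    finally show "(f \<star> y) x = smult \<mu> y x" .
  qed (use assms yA in auto)
  ultimately show thesis using that yA by blast
qed

text \<open>Schur's lemma in terms of ideals: for an eigenvalue \<mu> of multiplication by
  \<open>z\<close>, the elements on which \<open>z\<close> acts as \<mu> form a two-sided ideal,
  since \<open>z\<close> is central. It contains an eigenvector, hence also the unit.\<close>

lemma central_eq_scalar:
  assumes "simple_ring A" "z \<in> carrier A" "\<And>f. f \<in> carrier A \<Longrightarrow> f \<star> z = z \<star> f"
  obtains \<mu> where "z = smult \<mu> \<one>\<^bsub>A\<^esub>"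
proof -
  obtain \<mu> y where y: "y \<in> carrier A" "y \<noteq> \<zero>\<^bsub>A\<^esub>" "z \<star> y = smult \<mu> y"
    using eigenvector_exists[OF assms(2)] by blast
  define t where "t = smult \<mu> \<one>\<^bsub>A\<^esub>"
  have tA: "t \<in> carrier A" by (simp add: t_def)
  have t: "t \<star> a = smult \<mu> a" "a \<star> t = t \<star> a" if "a \<in> carrier A" for a
    using that by (simp_all add: t_def smult_conv conv_smult)
  define I where "I = {a \<in> carrier A. z \<star> a = t \<star> a}"
  note zt = assms(2) tA
  have "ideal I A"
  proof (rule idealI)
    show "ring A" by (rule A.ring_axioms)
    show "subgroup I (add_monoid A)"
    proof (rule A.add.subgroupI)
      have "\<zero>\<^bsub>A\<^esub> \<in> I" using zt by (simp add: I_def)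
      then show "I \<noteq> {}" by blast
      show "\<ominus>\<^bsub>A\<^esub> a \<in> I" if "a \<in> I" for a
        using that zt by (simp add: I_def A.r_minus)
      show "a \<oplus>\<^bsub>A\<^esub> b \<in> I" if "a \<in> I" "b \<in> I" for a b
        using that zt by (simp add: I_def A.r_distr)
    qed (auto simp: I_def)
    show "b \<star> a \<in> I" if "a \<in> I" "b \<in> carrier A" for a b
    proof -
      have a: "a \<in> carrier A" "z \<star> a = t \<star> a" using that by (auto simp: I_def)
      have "z \<star> (b \<star> a) = b \<star> (z \<star> a)"
        using a(1) that(2) zt assms(3)[of b] by (metis A.m_assoc)
      also have "\<dots> = t \<star> (b \<star> a)"
        using a that(2) zt t(2)[of b] by (metis A.m_assoc)
      finally show ?thesis using a that(2) by (simp add: I_def)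
    qed
    show "a \<star> b \<in> I" if "a \<in> I" "b \<in> carrier A" for a b
    proof -
      have a: "a \<in> carrier A" "z \<star> a = t \<star> a" using that by (auto simp: I_def)
      then have "z \<star> (a \<star> b) = t \<star> (a \<star> b)" using that(2) zt by (metis A.m_assoc)
      then show ?thesis using a that(2) by (simp add: I_def)
    qed
  qed
  moreover have "y \<in> I" using y t(1)[of y] by (simp add: I_def)
  ultimately have "I = carrier A"
    using assms(1) y(2) unfolding simple_ring_def by blast
  then have "\<one>\<^bsub>A\<^esub> \<in> I" by simp
  then have "z = smult \<mu> \<one>\<^bsub>A\<^esub>" using zt by (simp add: I_def t_def)
  then show thesis by (rule that)
qed

text \<open>Lets the results on averages be applied with \<open>N\<close> and \<open>S\<close> both
  the whole group.\<close>

lemma carrier_in_rcosets: "carrier G \<in> rcosets (carrier G)"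
  using subgroup.subgroup_in_rcosets[OF subgroup_self] is_group by blast

text \<open>For a nontrivial regular \<open>n\<close>, the coefficient at \<open>n\<close> of the
  average of \<open>u n\<close> counts the elements commuting with \<open>n\<close>, so it is
  positive; but the average is central, hence a scalar, with coefficient 0 at
  \<open>n\<close>.\<close>

lemma simple_imp_separating:
  assumes "simple_ring A"
  shows "separating (carrier G)"
proof (rule ccontr)
  assume "\<not> separating (carrier G)"
  then obtain n where n: "n \<in> carrier G" "n \<noteq> \<one>"
    and sym: "\<And>c. c \<in> carrier G \<Longrightarrow> c \<otimes> n = n \<otimes> c \<Longrightarrow> \<alpha> (c, n) = \<alpha> (n, c)"
    unfolding separating_def by blast
  define z where "z = average (carrier G) (u n)"
  have zA: "z \<in> carrier A" using normal_self by (simp add: z_def)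
  have "z \<in> centralizer (carrier G) (carrier G)"
    unfolding z_def
    by (rule average_centralizer[OF normal_self]) (simp_all add: carrier_in_rcosets)
  then have "f \<star> z = z \<star> f" if "f \<in> carrier A" for f
    using centralizer_commute that by blast
  then obtain \<mu> where z: "z = smult \<mu> \<one>\<^bsub>A\<^esub>" using central_eq_scalar[OF assms zA] by blast
  then have "z n = 0" using n by (auto simp: smult_def one_A u_def)
  have "z n = (\<Sum>c \<in> carrier G. if c \<otimes> n = n \<otimes> c then 1 else 0)"
    unfolding z_def using n sym cocycle_nonzero
    by (subst average_apply[OF normal_self]) (auto simp: u_conj_u_apply intro!: sum.cong)
  also have "\<dots> = of_nat (card {c \<in> carrier G. c \<otimes> n = n \<otimes> c})"
    using finite_carrier by (simp add: sum.If_cases Int_def)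
  finally have "card {c \<in> carrier G. c \<otimes> n = n \<otimes> c} = 0" using \<open>z n = 0\<close> by simp
  moreover have "\<one> \<in> {c \<in> carrier G. c \<otimes> n = n \<otimes> c}" using n by simp
  ultimately show False using finite_carrier by auto
qed

lemma finsum_in_ideal:
  assumes "ideal I A" "finite S" "\<And>i. i \<in> S \<Longrightarrow> f i \<in> I"
  shows "(\<Oplus>\<^bsub>A\<^esub>i \<in> S. f i) \<in> I"
proof -
  interpret I: ideal I A by fact
  show ?thesis using assms(2,3)
  proof (induction S)
    case (insert i S)
    then have "(\<Oplus>\<^bsub>A\<^esub>i \<in> insert i S. f i) = f i \<oplus>\<^bsub>A\<^esub> (\<Oplus>\<^bsub>A\<^esub>i \<in> S. f i)"
      by (intro A.finsum_insert) auto
    then show ?case using insert I.a_closed by simp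
  qed simp
qed

text \<open>Dividing by \<open>u g\<close> moves a nonzero coefficient of an element of the ideal to
  \<open>\<one>\<close>; the average then stays in the ideal and is a nonzero scalar.\<close>

lemma separating_imp_simple:
  assumes "separating (carrier G)"
  shows "simple_ring A"
  unfolding simple_ring_def
proof (intro conjI allI impI)
  show "ring A" by (rule A.ring_axioms)
  show "\<one>\<^bsub>A\<^esub> \<noteq> \<zero>\<^bsub>A\<^esub>" by (rule one_neq_zero)
  fix I assume I: "ideal I A"
  interpret I: ideal I A by fact
  show "I = {\<zero>\<^bsub>A\<^esub>} \<or> I = carrier A"
  proof (cases "I = {\<zero>\<^bsub>A\<^esub>}")
    case False
    then obtain f where f: "f \<in> I" "f \<noteq> \<zero>\<^bsub>A\<^esub>" using I.zero_closed by blast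
    have fA: "f \<in> carrier A" using f by simp
    obtain g where g: "g \<in> carrier G" "f g \<noteq> 0" using A_nonzeroE[OF fA f(2)] by blast
    define z where "z = f \<star> inv\<^bsub>A\<^esub> (u g)"
    have z: "z \<in> I" "z \<one> \<noteq> 0"
      using f(1) g conv_inv_u_apply_one[OF fA g] by (auto simp: z_def intro: I.I_r_closed)
    have zA: "z \<in> carrier A" using z by simp
    define w where "w = average (carrier G) z"
    have "w \<in> I"
      unfolding w_def average_def u_conj_def
      using finite_carrier z(1) by (intro finsum_in_ideal[OF I] I.I_r_closed I.I_l_closed) auto
    have "w \<in> centralizer (carrier G) (carrier G)"
      unfolding w_def
      by (rule average_centralizer[OF normal_self]) (simp_all add: carrier_in_rcosets zA)
    from centralizer_scalar[OF assms subgroup_self this]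
    have w: "w = smult (w \<one> * \<alpha> (\<one>, \<one>)) \<one>\<^bsub>A\<^esub>" .
    have nz: "w \<one> * \<alpha> (\<one>, \<one>) \<noteq> 0"
      using average_apply_one[OF normal_self zA] card_normal_pos[OF normal_self] z(2) cocycle_nonzero[of \<one> \<one>]
      by (simp add: w_def)
    have "\<one>\<^bsub>A\<^esub> = smult (inverse (w \<one> * \<alpha> (\<one>, \<one>))) (smult (w \<one> * \<alpha> (\<one>, \<one>)) \<one>\<^bsub>A\<^esub>)"
      by (simp only: smult_smult left_inverse[OF nz] smult_1[OF A.one_closed])
    also have "\<dots> = smult (inverse (w \<one> * \<alpha> (\<one>, \<one>))) w"
      using w by simp
    \<comment> \<open>\<open>I\<close> is an ideal of the ring; \<open>twisted_ideal_scale\<close>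
      supplies closure under complex scalars.\<close>
    also have "\<dots> \<in> I"
      unfolding smult_def using twisted_ideal_scale[OF is_group finite_carrier cocycle I \<open>w \<in> I\<close>] .
    finally show ?thesis using I.one_imp_carrier by blast
  qed simp
qed

section \<open>The cocycle of the quotient\<close>

text \<open>Phrased with \<open>separating\<close> throughout, so that simplicity enters only
  through the criterion. The values of \<beta> measure the failure of the chosen \<open>v S\<close>
  to be multiplicative.\<close>

lemma quotient_cocycle:
  assumes N: "N \<lhd> G" and sepN: "separating N" and sepG: "separating (carrier G)"
  obtains \<beta> where "\<beta> \<in> carrier (Z2 (G Mod N))"
    "twisted_algebra.separating (G Mod N) \<beta> (carrier (G Mod N))"
proof -
  interpret N: normal N G by (rule N)
  let ?Q = "G Mod N"
  interpret Q: group ?Q by (rule N.factorgroup_is_group)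
  have NG: "N \<subseteq> carrier G" by (rule N.subset)
  have rc: "S \<in> rcosets N \<longleftrightarrow> S \<in> carrier ?Q" for S by (rule rcosets_iff[OF N])
  have inv_mult: "set_inv S <#> S = N" if "S \<in> carrier ?Q" for S
    using N.rcosets_inv_mult_group_eq that rc by blast
  have Qm: "S <#> T \<in> carrier ?Q" if "S \<in> carrier ?Q" "T \<in> carrier ?Q" for S T
    using Q.m_closed[OF that] by simp
  have Qa: "S <#> T <#> R = S <#> (T <#> R)"
    if "S \<in> carrier ?Q" "T \<in> carrier ?Q" "R \<in> carrier ?Q" for S T R
    using Q.m_assoc[OF that] by simp

  have "\<exists>v w. v \<in> centralizer N S \<and> w \<in> centralizer N (set_inv S) \<and> v \<star> w = \<one>\<^bsub>A\<^esub>"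
    if "S \<in> carrier ?Q" for S
  proof -
    have S: "S \<in> rcosets N" using that rc by blast
    obtain v y where v: "v \<in> centralizer N S" "y \<in> carrier G" "v y \<noteq> 0"
      using ex_centralizer_nonzero[OF N sepN S] .
    obtain w where "w \<in> centralizer N (set_inv S)" "v \<star> w = \<one>\<^bsub>A\<^esub>"
      using centralizer_right_inverse[OF N sepN S v] .
    then show ?thesis using v(1) by blast
  qed
  then obtain v w where v: "\<And>S. S \<in> carrier ?Q \<Longrightarrow> v S \<in> centralizer N S"
    and w: "\<And>S. S \<in> carrier ?Q \<Longrightarrow> w S \<in> centralizer N (set_inv S)"
    and vw: "\<And>S. S \<in> carrier ?Q \<Longrightarrow> v S \<star> w S = \<one>\<^bsub>A\<^esub>"
    by metis
  note vA = centralizerD(1)[OF v] and wA = centralizerD(1)[OF w]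
  have v_nz: "v S \<noteq> \<zero>\<^bsub>A\<^esub>" if "S \<in> carrier ?Q" for S
    using vw[OF that] wA[OF that] one_neq_zero by auto

  \<comment> \<open>Uniqueness up to scalars: \<open>w S \<star> x\<close> has degree
    \<open>N\<close> and centralizes the subalgebra of \<open>N\<close>, hence is a scalar;
    multiplying by \<open>v S\<close> on the left recovers \<open>x\<close>.\<close>
  have "\<exists>c. x = smult c (v S)" if S: "S \<in> carrier ?Q" and x: "x \<in> centralizer N S" for S x
  proof -
    have "w S \<star> x \<in> centralizer N N"
      using centralizer_conv[OF w[OF S] x NG] inv_mult[OF S] by simp
    then obtain c where c: "w S \<star> x = smult c \<one>\<^bsub>A\<^esub>"
      using centralizer_scalar[OF sepN N.is_subgroup] by blast
    have xA: "x \<in> carrier A" using centralizerD(1)[OF x] .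
    have "x = v S \<star> (w S \<star> x)"
      using vA[OF S] wA[OF S] xA by (simp add: vw[OF S] flip: A.m_assoc)
    also have "\<dots> = smult c (v S)" using vA[OF S] by (simp add: c conv_smult)
    finally show ?thesis by blast
  qed
  then have "\<exists>c. v S \<star> v T = smult c (v (S <#> T))"
    if "S \<in> carrier ?Q" "T \<in> carrier ?Q" for S T
    using centralizer_conv[OF v[OF that(1)] v[OF that(2)] NG] Qm[OF that] by blast
  then obtain b where b: "\<And>S T. S \<in> carrier ?Q \<Longrightarrow> T \<in> carrier ?Q \<Longrightarrow>
      v S \<star> v T = smult (b S T) (v (S <#> T))"
    by metis
  have b_nz: "b S T \<noteq> 0" if S: "S \<in> carrier ?Q" and T: "T \<in> carrier ?Q" for S T
  proof
    assume "b S T = 0"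
    then have "v S \<star> v T = \<zero>\<^bsub>A\<^esub>" using b[OF S T] by (simp add: smult_0)
    then have "v S \<star> (v T \<star> w T) = \<zero>\<^bsub>A\<^esub>"
      using vA[OF S] vA[OF T] wA[OF T] by (simp flip: A.m_assoc)
    then show False using vA[OF S] v_nz[OF S] by (simp add: vw[OF T])
  qed
  \<comment> \<open>Associativity of the product of \<open>v S\<close>, \<open>v T\<close> and
    \<open>v R\<close>, read as an equality of scalars in front of one nonzero element.\<close>
  have b_coc: "b S T * b (S <#> T) R = b T R * b S (T <#> R)"
    if S: "S \<in> carrier ?Q" and T: "T \<in> carrier ?Q" and R: "R \<in> carrier ?Q" for S T R
  proof -
    have "v S \<star> v T \<star> v R = v S \<star> (v T \<star> v R)"
      using vA S T R by (simp add: A.m_assoc)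
    then have "smult (b S T * b (S <#> T) R) (v (S <#> T <#> R)) =
        smult (b T R * b S (T <#> R)) (v (S <#> T <#> R))"
      using S T R Qm by (simp add: b smult_conv conv_smult smult_smult Qa)
    then show ?thesis
      by (rule smult_right_cancel[OF _ vA v_nz]) (use Qm S T R in auto)
  qed
  define \<beta> where "\<beta> = (\<lambda>(S, T) \<in> carrier ?Q \<times> carrier ?Q. b S T)"
  have \<beta>: "\<beta> (S, T) = b S T" if "S \<in> carrier ?Q" "T \<in> carrier ?Q" for S T
    using that by (simp add: \<beta>_def)
  have Z2: "\<beta> \<in> carrier (Z2 ?Q)"
  proof -
    have "\<beta> \<in> carrier ?Q \<times> carrier ?Q \<rightarrow>\<^sub>E UNIV - {0}"
      using b_nz by (auto simp: \<beta>_def)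
    moreover have "\<beta> (S, T) * \<beta> (S <#> T, R) = \<beta> (T, R) * \<beta> (S, T <#> R)"
      if "S \<in> carrier ?Q" "T \<in> carrier ?Q" "R \<in> carrier ?Q" for S T R
      using that b_coc Qm by (simp add: \<beta>)
    ultimately show ?thesis by (simp add: Z2_def)
  qed
  have "finite (carrier ?Q)"
    using finite_carrier by (simp add: carrier_FactGroup)
  then interpret Q: twisted_algebra ?Q \<beta>
    using Z2 by unfold_locales
  have "Q.separating (carrier ?Q)"
    unfolding Q.separating_def
  proof (intro ballI, rule ccontr)
    fix S assume S': "S \<in> carrier ?Q - {\<one>\<^bsub>?Q\<^esub>}"
      and "\<not> (\<exists>T \<in> carrier ?Q. T \<otimes>\<^bsub>?Q\<^esub> S = S \<otimes>\<^bsub>?Q\<^esub> T \<and> \<beta> (T, S) \<noteq> \<beta> (S, T))"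
    then have sym: "\<beta> (T, S) = \<beta> (S, T)" if "T \<in> carrier ?Q" "T <#> S = S <#> T" for T
      using that by auto
    have S: "S \<in> carrier ?Q" "S \<noteq> N" using S' by auto
    obtain y where y: "y \<in> carrier G" "v S y \<noteq> 0"
      using A_nonzeroE[OF vA[OF S(1)] v_nz[OF S(1)]] .
    then have yS: "y \<in> S" using centralizerD(2)[OF v[OF S(1)]] by blast
    have Sy: "S = N #> y"
      using S(1) yS repr_independence N.is_subgroup by (auto simp: carrier_FactGroup)
    then have "y \<noteq> \<one>" using S(2) NG by auto
    then obtain c where c: "c \<in> carrier G" "c \<otimes> y = y \<otimes> c" "\<alpha> (c, y) \<noteq> \<alpha> (y, c)"
      using sepG y(1) unfolding separating_def by blast
    define T where "T = N #> c"
    have T: "T \<in> carrier ?Q" using c(1) by (auto simp: T_def carrier_FactGroup)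
    have TS: "T <#> S = S <#> T"
      using c y(1) by (simp add: T_def Sy N.rcos_sum)
    have vTS: "v T \<star> v S = v S \<star> v T"
      using b[OF T S(1)] b[OF S(1) T] sym[OF T TS] TS by (simp add: \<beta> T S(1))
    \<comment> \<open>\<open>u c\<close> factors as \<open>v T \<star> d\<close> with
      \<open>d\<close> in the subalgebra of \<open>N\<close>. Both factors commute with
      \<open>v S\<close>: the first by the assumed regularity of \<open>S\<close>, the second
      because \<open>v S\<close> centralizes that subalgebra.\<close>
    define d where "d = w T \<star> u c"
    have dA: "d \<in> carrier A" using wA[OF T] by (simp add: d_def)
    have "x \<in> N" if x: "x \<in> carrier G" and nz: "d x \<noteq> 0" for x
    proof -
      obtain g h where gh: "g \<in> carrier G" "h \<in> carrier G" "x = g \<otimes> h" "w T g \<noteq> 0" "u c h \<noteq> 0"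
        using conv_supportE[OF nz[unfolded d_def] x] .
      have "h = c" using gh(2,5) by (auto simp: u_def split: if_splits)
      then have "h \<in> T" using c(1) rcos_self[OF _ N.is_subgroup] by (simp add: T_def)
      moreover have "g \<in> set_inv T" using centralizerD(2)[OF w[OF T]] gh by blast
      ultimately have "x \<in> set_inv T <#> T" using gh(3) unfolding set_mult_def by blast
      then show ?thesis using inv_mult[OF T] by simp
    qed
    then have dS: "d \<star> v S = v S \<star> d" using centralizer_commute[OF v[OF S(1)] dA] by blast
    have uc: "u c = v T \<star> d"
      using vA[OF T] wA[OF T] by (simp add: d_def vw[OF T] flip: A.m_assoc)
    have "v S \<star> u c = u c \<star> v S"
      unfolding uc using vA[OF T] vA[OF S(1)] dA dS vTS by (metis A.m_assoc)
    \<comment> \<open>The coefficient at \<open>c \<otimes> y\<close> gives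
      \<open>\<alpha> (c, y) = \<alpha> (y, c)\<close>, against the choice of
      \<open>c\<close>.\<close>
    then show False using commute_u_apply c y by blast
  qed
  then show thesis using that Z2 by blast
qed

end

section \<open>From cohomology classes to the criterion and back\<close>

theorem corollaryB:
  fixes G :: "('a, 'm) monoid_scheme" and N :: "'a set" and \<alpha> :: "'a \<times> 'a \<Rightarrow> complex"
  assumes "central_type G"
    and "N \<lhd> G"
    and "\<alpha> \<in> carrier (Z2 G)"
    and "nondegenerate G (cohomology_class G \<alpha>)"
    and "nondegenerate (G\<lparr>carrier := N\<rparr>)
           (cohomology_class (G\<lparr>carrier := N\<rparr>) (restrict \<alpha> (N \<times> N)))"
  shows "central_type (G Mod N)"
proof -
  let ?K = "G\<lparr>carrier := N\<rparr>" and ?\<gamma> = "restrict \<alpha> (N \<times> N)"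
  have G: "group G" "finite (carrier G)" using assms(1) by (auto simp: central_type_def)
  interpret G: twisted_algebra G \<alpha>
    using G assms(3) by (simp add: twisted_algebra_def twisted_algebra_axioms_def)
  have N: "subgroup N G" using assms(2) by (rule normal_imp_subgroup)
  have K: "group ?K" "finite (carrier ?K)" "?\<gamma> \<in> carrier (Z2 ?K)"
    using G.subgroup_imp_group[OF N] finite_subset[OF subgroup.subset[OF N] G(2)]
      restrict_in_Z2[OF G(1) N assms(3)] by auto
  interpret K: twisted_algebra ?K ?\<gamma>
    using K by (simp add: twisted_algebra_def twisted_algebra_axioms_def)
  have "K.separating (carrier ?K)"
    using K.simple_imp_separating assms(5) nondegenerate_iff[OF K] by blast
  \<comment> \<open>The subgroup has the multiplication and unit of \<open>G\<close>, and the
    restricted cocycle agrees with \<alpha> on \<open>N\<close>, so both conditions say the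
    same.\<close>
  then have sepN: "G.separating N"
    unfolding K.separating_def G.separating_def by fastforce
  have sepG: "G.separating (carrier G)"
    using G.simple_imp_separating assms(4) nondegenerate_iff[OF G assms(3)] by blast
  obtain \<beta> where \<beta>: "\<beta> \<in> carrier (Z2 (G Mod N))"
    and sep: "twisted_algebra.separating (G Mod N) \<beta> (carrier (G Mod N))"
    using G.quotient_cocycle[OF assms(2) sepN sepG] .
  have Q: "group (G Mod N)" "finite (carrier (G Mod N))"
    using normal.factorgroup_is_group[OF assms(2)] G(2) by (auto simp: carrier_FactGroup)
  interpret Q: twisted_algebra "G Mod N" \<beta>
    using Q \<beta> by (simp add: twisted_algebra_def twisted_algebra_axioms_def)
  have "nondegenerate (G Mod N) (cohomology_class (G Mod N) \<beta>)"
    using nondegenerate_iff[OF Q \<beta>] Q.separating_imp_simple[OF sep] by blast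
  then show ?thesis
    using Q cohomology_class_in_H2[OF \<beta>] by (auto simp: central_type_def)
qed

end
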